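(* Let $\mathfrak{F}$ be a saturated formation of finite groups containing the class $\mathfrak{U}$ of all finite supersoluble groups. Let $G$ be a finite group and $H$ a normal subgroup of $G$ such that $G/H\in\mathfrak{F}$ and $\Phi(G)\cap H\leq\Phi(H)$. If, for every maximal subgroup $M$ of $G$, the index $|\tilde{\mathrm{F}}(H):\tilde{\mathrm{F}}(H)\cap M|$ is equal to $1$ or to a prime, then $G\in\mathfrak{F}$.
   Context: All groups are finite. $\Phi(X)$ denotes the Frattini subgroup of a group $X$. A formation is a class of groups closed under homomorphic images and such that if $G/N_1$ and $G/N_2$ lie in it then so does $G/(N_1\cap N_2)$; it is saturated if $G/\Phi(G)\in\mathfrak{F}$ implies $G\in\mathfrak{F}$. For a group $X$, $\tilde{\mathrm{F}}(X)$ denotes the subgroup of $X$ containing $\Phi(X)$ defined by $\tilde{\mathrm{F}}(X)/\Phi(X)=\mathrm{Soc}(X/\Phi(X))$, the socle (product of all minimal normal subgroups) of $X/\Phi(X)$. *)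

theory Defs
  imports "HOL-Algebra.Algebra"
begin

definition maximal_subgroup :: "'a set \<Rightarrow> ('a, 'b) monoid_scheme \<Rightarrow> bool" where
  "maximal_subgroup M G \<longleftrightarrow> subgroup M G \<and> M \<noteq> carrier G \<and>
     (\<forall>K. subgroup K G \<and> M \<subseteq> K \<longrightarrow> K = M \<or> K = carrier G)"

text \<open>Frattini subgroup: intersection of all maximal subgroups (the whole group if there are none).\<close>
definition frattini :: "('a, 'b) monoid_scheme \<Rightarrow> 'a set" where
  "frattini G = carrier G \<inter> \<Inter> {M. maximal_subgroup M G}"

definition minimal_normal :: "'a set \<Rightarrow> ('a, 'b) monoid_scheme \<Rightarrow> bool" where
  "minimal_normal N G \<longleftrightarrow> N \<lhd> G \<and> N \<noteq> {\<one>\<^bsub>G\<^esub>} \<and>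
     (\<forall>K. K \<lhd> G \<and> K \<subseteq> N \<longrightarrow> K = {\<one>\<^bsub>G\<^esub>} \<or> K = N)"

definition socle :: "('a, 'b) monoid_scheme \<Rightarrow> 'a set" where
  "socle G = generate G (\<Union> {N. minimal_normal N G})"

definition gen_fitting_tilde :: "('a, 'b) monoid_scheme \<Rightarrow> 'a set" where
  "gen_fitting_tilde K =
     {x \<in> carrier K. r_coset K (frattini K) x \<in> socle (K Mod frattini K)}"

definition supersoluble :: "('a, 'b) monoid_scheme \<Rightarrow> bool" where
  "supersoluble G \<longleftrightarrow> group G \<and> (\<exists>Ns :: 'a set list. Ns \<noteq> [] \<and>
     hd Ns = {\<one>\<^bsub>G\<^esub>} \<and> last Ns = carrier G \<and> (\<forall>N \<in> set Ns. N \<lhd> G) \<and>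
     (\<forall>i. Suc i < length Ns \<longrightarrow> Ns ! i \<subseteq> Ns ! Suc i \<and>
        cyclic_group ((G\<lparr>carrier := Ns ! Suc i\<rparr>) Mod (Ns ! i))))"

text \<open>A class of finite groups is represented by a predicate on groups with carrier in nat
  (every finite group has an isomorphic copy there); a group K of any type belongs to the
  class iff it is a finite group isomorphic to a member.\<close>
definition in_class :: "(nat monoid \<Rightarrow> bool) \<Rightarrow> ('a, 'b) monoid_scheme \<Rightarrow> bool" where
  "in_class F K \<longleftrightarrow> group K \<and> finite (carrier K) \<and>
     (\<exists>Y :: nat monoid. F Y \<and> group Y \<and> finite (carrier Y) \<and> K \<cong> Y)"

definition formation :: "(nat monoid \<Rightarrow> bool) \<Rightarrow> bool" where
  "formation F \<longleftrightarrow>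
    (\<forall>G :: nat monoid. \<forall>N. group G \<and> finite (carrier G) \<and> in_class F G \<and> N \<lhd> G
        \<longrightarrow> in_class F (G Mod N)) \<and>
    (\<forall>G :: nat monoid. \<forall>N1 N2. group G \<and> finite (carrier G) \<and> N1 \<lhd> G \<and> N2 \<lhd> G \<and>
        in_class F (G Mod N1) \<and> in_class F (G Mod N2) \<longrightarrow> in_class F (G Mod (N1 \<inter> N2)))"

definition saturated_formation :: "(nat monoid \<Rightarrow> bool) \<Rightarrow> bool" where
  "saturated_formation F \<longleftrightarrow> formation F \<and>
    (\<forall>G :: nat monoid. group G \<and> finite (carrier G) \<and> in_class F (G Mod frattini G)
        \<longrightarrow> in_class F G)"

end

theory Submission
  imports Defs "HOL-Number_Theory.Residues"
begin

text \<open>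
  Factoring out \<open>\<Phi>(H)\<close>, which lies in \<open>\<Phi>(G)\<close>, we may assume by saturation that
  \<open>\<Phi>(G) \<inter> H = 1\<close>, and the subgroup \<open>T\<close> of the index condition becomes the socle of \<open>H\<close>; it
  contains every minimal normal subgroup of \<open>G\<close> inside \<open>H\<close>. Let \<open>N\<close> be one of these. Some
  maximal \<open>M\<close> does not contain \<open>N\<close>, and then \<open>|N : N \<inter> M| = |G : M| = |T : T \<inter> M|\<close> is prime.
  If \<open>Q\<close> is a Sylow \<open>p\<close>-subgroup of \<open>N\<close> for the largest prime \<open>p\<close> dividing \<open>|N|\<close> and
  \<open>N\<^sub>G(Q)\<close> lay in a maximal subgroup \<open>M'\<close>, then \<open>|N : N \<inter> M'|\<close> would be a prime divisor of
  \<open>|N|\<close> congruent to 1 modulo \<open>p\<close>, hence larger than \<open>p\<close>. So \<open>N = Q\<close> is a \<open>p\<close>-group,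
  \<open>N \<inter> M\<close> is normal in \<open>NM = G\<close>, and \<open>|N| = p\<close>.
  Now \<open>L = C\<^sub>G(N) \<inter> M\<close> is normal in \<open>G\<close>, avoids \<open>N\<close>, and \<open>G/L\<close> is an extension of a group of
  order \<open>p\<close> by a subgroup of its cyclic automorphism group, hence supersoluble. A smallest normal
  subgroup \<open>K \<le> H\<close> of \<open>G\<close> with \<open>G/K\<close> in the formation must be trivial: otherwise it contains
  such an \<open>N\<close>, and \<open>K \<inter> L\<close> is smaller.
\<close>

section \<open>Actions of \<open>p\<close>-groups on cosets\<close>

text \<open>Every orbit has \<open>p\<close>-power length. An orbit of length 1 is a fixed point and
  contributes nothing; a longer orbit consists of moved points only and contributes a multiple of
  \<open>p\<close>. The function \<open>?f\<close> is the indicator of the moved points.\<close>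

lemma (in group_action) p_group_dvd_card_moved:
  assumes p: "Factorial_Ring.prime p" and ord: "order G = p ^ a" and fin: "finite E"
  shows "p dvd card {x \<in> E. \<exists>g\<in>carrier G. \<phi> g x \<noteq> x}"
proof -
  let ?f = "\<lambda>x. if \<exists>g\<in>carrier G. \<phi> g x \<noteq> x then 1 else (0::nat)"
  have "p dvd (\<Sum>y\<in>orb. ?f y)" if "orb \<in> orbits G E \<phi>" for orb
  proof -
    obtain x where x: "x \<in> E" "orb = orbit G \<phi> x"
      using \<open>orb \<in> orbits G E \<phi>\<close> by (auto simp: orbits_def)
    have sub: "orb \<subseteq> E"
      using x element_image by (auto simp: orbit_def)
    have same: "orbit G \<phi> y = orb" if "y \<in> orb" for y
      using that x sub orbit_sym[of x y] orbit_trans[of x y] orbit_trans[of y x] element_image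
      unfolding orbit_def by blast
    have "card orb dvd p ^ a"
      using orbit_stabilizer_theorem[OF x(1)] x(2) ord by (metis dvd_triv_left)
    then obtain i where i: "card orb = p ^ i"
      using divides_primepow_nat[OF p] by blast
    show ?thesis
    proof (cases i)
      case 0
      then have "orb = {x}"
        using i x orbit_refl[of x] by (auto simp: card_1_singleton_iff)
      moreover have "\<phi> g x = x" if "g \<in> carrier G" for g
        using that x(2) \<open>orb = {x}\<close> unfolding orbit_def by blast
      ultimately show ?thesis by simp
    next
      case (Suc j)
      have "\<exists>g\<in>carrier G. \<phi> g y \<noteq> y" if "y \<in> orb" for y
      proof (rule ccontr)
        assume "\<not> ?thesis"
        then have "orbit G \<phi> y \<subseteq> {y}"
          by (auto simp: orbit_def)
        then have "card orb \<le> 1"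
          using same[OF that] card_mono[of "{y}" orb] by simp
        then show False
          using i Suc p by (metis One_nat_def leD one_less_power prime_gt_1_nat zero_less_Suc)
      qed
      then have "(\<Sum>y\<in>orb. ?f y) = card orb" by simp
      then show ?thesis using i Suc by simp
    qed
  qed
  then have "p dvd (\<Sum>orb\<in>orbits G E \<phi>. \<Sum>y\<in>orb. ?f y)"
    by (rule dvd_sum)
  also have "\<dots> = (\<Sum>x\<in>E. ?f x)"
    by (rule disjoint_sum[OF fin])
  also have "\<dots> = card {x \<in> E. \<exists>g\<in>carrier G. \<phi> g x \<noteq> x}"
    using fin by (simp add: sum.If_cases Int_def)
  finally show ?thesis .
qed

lemma (in group) rcoset_mult_right_mem:
  assumes "subgroup K G" "C \<in> rcosets K" "x \<in> carrier G"
  shows "C #> x \<in> rcosets K"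
  using assms by (auto simp: RCOSETS_def coset_mult_assoc subgroup.subset)

text \<open>Multiplying by \<open>inv r\<close> on the right turns the right action on right cosets
  into a left action. The maps are restricted to \<open>rcosets K\<close> because the members of
  \<open>BijGroup\<close> are extensional.\<close>

lemma (in group) group_action_rcosets:
  assumes R: "subgroup R G" and K: "subgroup K G"
  shows "group_action (G\<lparr>carrier := R\<rparr>) (rcosets K) (\<lambda>r. \<lambda>C\<in>rcosets K. C #> inv r)"
proof -
  let ?\<phi> = "\<lambda>r. \<lambda>C\<in>rcosets K. C #> inv r"
  have sub: "C \<subseteq> carrier G" if "C \<in> rcosets K" for C
    using that K subgroup.rcosets_carrier group_axioms by blast
  have bij: "?\<phi> r \<in> Bij (rcosets K)" if "r \<in> carrier G" for r
  proof -
    have "bij_betw (\<lambda>C. C #> inv r) (rcosets K) (rcosets K)"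
      by (rule bij_betw_byWitness[where f' = "\<lambda>C. C #> r"])
        (use that K sub rcoset_mult_right_mem in \<open>auto simp: coset_mult_assoc\<close>)
    then show ?thesis
      by (simp add: Bij_def cong: bij_betw_cong)
  qed
  have "?\<phi> \<in> hom (G\<lparr>carrier := R\<rparr>) (BijGroup (rcosets K))"
  proof (rule homI)
    fix x y assume "x \<in> carrier (G\<lparr>carrier := R\<rparr>)" "y \<in> carrier (G\<lparr>carrier := R\<rparr>)"
    then have xy: "x \<in> carrier G" "y \<in> carrier G"
      using R subgroup.mem_carrier by fastforce+
    have "?\<phi> (x \<otimes> y) = compose (rcosets K) (?\<phi> x) (?\<phi> y)"
      by (rule ext) (use xy sub rcoset_mult_right_mem[OF K] in
          \<open>auto simp: compose_def restrict_def coset_mult_assoc inv_mult_group\<close>)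
    then show "?\<phi> (x \<otimes>\<^bsub>G\<lparr>carrier := R\<rparr>\<^esub> y) = ?\<phi> x \<otimes>\<^bsub>BijGroup (rcosets K)\<^esub> ?\<phi> y"
      using bij xy by (simp add: BijGroup_def)
  qed (use bij subgroup.mem_carrier[OF R] in \<open>simp add: BijGroup_def\<close>)
  then show ?thesis
    using R by (simp add: group_action_def group_hom_def group_hom_axioms_def
        group_BijGroup subgroup_imp_group)
qed

lemma (in group) p_subgroup_dvd_card_moved_rcosets:
  assumes fin: "finite (carrier G)" and p: "Factorial_Ring.prime p"
    and R: "subgroup R G" "card R = p ^ a" and K: "subgroup K G"
  shows "p dvd card {C \<in> rcosets K. \<exists>r\<in>R. C #> r \<noteq> C}"
proof -
  have finE: "finite (rcosets K)"
    using fin by (simp add: RCOSETS_def)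
  have "(\<exists>r\<in>R. C #> inv r \<noteq> C) \<longleftrightarrow> (\<exists>r\<in>R. C #> r \<noteq> C)" for C
    using subgroup.m_inv_closed[OF R(1)] subgroup.mem_carrier[OF R(1)] inv_inv by metis
  then have "{C \<in> rcosets K. \<exists>r\<in>carrier (G\<lparr>carrier := R\<rparr>). (\<lambda>C\<in>rcosets K. C #> inv r) C \<noteq> C}
      = {C \<in> rcosets K. \<exists>r\<in>R. C #> r \<noteq> C}"
    by (simp cong: conj_cong)
  then show ?thesis
    using group_action.p_group_dvd_card_moved[OF group_action_rcosets[OF R(1) K] p _ finE, of a] R(2)
    by (simp add: order_def)
qed

text \<open>The right-hand side is an inverse-free form of
  \<open>g \<otimes> r \<otimes> inv g \<in> K\<close>. So \<open>R\<close> fixes the coset of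
  \<open>g\<close> exactly when \<open>g\<close> conjugates \<open>R\<close> into
  \<open>K\<close>.\<close>

lemma (in group) rcoset_fixed_iff:
  assumes K: "subgroup K G" and "g \<in> carrier G" "r \<in> carrier G"
  shows "(K #> g) #> r = K #> g \<longleftrightarrow> g \<otimes> r \<in> K #> g"
proof -
  have "(K #> g) #> r = K #> (g \<otimes> r)"
    using assms by (simp add: coset_mult_assoc subgroup.subset)
  moreover have "g \<otimes> r \<in> K #> (g \<otimes> r)"
    using assms by (simp add: rcos_self)
  moreover have "K #> (g \<otimes> r) = K #> g" if "g \<otimes> r \<in> K #> g"
    using repr_independence[OF that assms(2) K] by simp
  ultimately show ?thesis by auto
qed

text \<open>If every coset were moved by \<open>R\<close>, their number would be divisible by
  \<open>p\<close>. A fixed coset gives a \<open>g\<close> conjugating \<open>R\<close> into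
  \<open>K\<close>, which is the conjugacy part of Sylow's theorem.\<close>

lemma (in group) p_subgroup_conj_into:
  assumes fin: "finite (carrier G)" and p: "Factorial_Ring.prime p"
    and R: "subgroup R G" "card R = p ^ a"
    and K: "subgroup K G" "\<not> p dvd card (rcosets K)"
  shows "\<exists>g\<in>carrier G. \<forall>r\<in>R. g \<otimes> r \<in> K #> g"
proof (rule ccontr)
  assume no: "\<not> ?thesis"
  have "{C \<in> rcosets K. \<exists>r\<in>R. C #> r \<noteq> C} = rcosets K"
  proof (rule Set.set_eqI, rule iffI)
    fix C assume C: "C \<in> rcosets K"
    then obtain g where g: "g \<in> carrier G" "C = K #> g" by (auto simp: RCOSETS_def)
    then obtain r where "r \<in> R" "g \<otimes> r \<notin> K #> g" using no by blast
    then show "C \<in> {C \<in> rcosets K. \<exists>r\<in>R. C #> r \<noteq> C}"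
      using C g rcoset_fixed_iff[OF K(1)] subgroup.mem_carrier[OF R(1)] by blast
  qed simp
  then show False
    using p_subgroup_dvd_card_moved_rcosets[OF fin p R K(1)] K(2) by simp
qed

text \<open>The assumption \<open>only\<close> makes \<open>K\<close> the sole coset fixed by
  \<open>R\<close>, so exactly the other cosets are moved. The truncated subtraction is harmless
  since \<open>K\<close> itself is a coset.\<close>

lemma (in group) p_subgroup_index_cong_one:
  assumes fin: "finite (carrier G)" and p: "Factorial_Ring.prime p"
    and R: "subgroup R G" "card R = p ^ a"
    and K: "subgroup K G" "R \<subseteq> K"
    and only: "\<And>g. \<lbrakk>g \<in> carrier G; \<forall>r\<in>R. g \<otimes> r \<in> K #> g\<rbrakk> \<Longrightarrow> g \<in> K"
  shows "p dvd card (rcosets K) - 1"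
proof -
  have KK: "K \<in> rcosets K"
    using K(1) group_axioms subgroup.subgroup_in_rcosets by blast
  have "{C \<in> rcosets K. \<exists>r\<in>R. C #> r \<noteq> C} = rcosets K - {K}"
  proof (rule Set.set_eqI, rule iffI)
    fix C assume "C \<in> {C \<in> rcosets K. \<exists>r\<in>R. C #> r \<noteq> C}"
    then show "C \<in> rcosets K - {K}"
      using K coset_join2 subgroup.mem_carrier[OF R(1)] by auto
  next
    fix C assume C: "C \<in> rcosets K - {K}"
    then obtain g where g: "g \<in> carrier G" "C = K #> g" by (auto simp: RCOSETS_def)
    then have "g \<notin> K" using C coset_join2[OF g(1) K(1)] by blast
    then obtain r where "r \<in> R" "g \<otimes> r \<notin> K #> g" using only g(1) by blast
    then show "C \<in> {C \<in> rcosets K. \<exists>r\<in>R. C #> r \<noteq> C}"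
      using C g rcoset_fixed_iff[OF K(1)] subgroup.mem_carrier[OF R(1)] by blast
  qed
  then show ?thesis
    using p_subgroup_dvd_card_moved_rcosets[OF fin p R K(1)] KK by (simp add: card_Diff_singleton)
qed

text \<open>Acting on its own \<open>p\<close> cosets, \<open>K\<close> fixes the coset
  \<open>K\<close>, so fewer than \<open>p\<close> cosets are moved. Their number is a multiple of
  \<open>p\<close>, hence 0, and all cosets being fixed says that every conjugate of
  \<open>K\<close> lies in \<open>K\<close>.\<close>

lemma (in group) normal_if_index_prime_p_group:
  assumes fin: "finite (carrier G)" and p: "Factorial_Ring.prime p" and ord: "order G = p ^ a"
    and K: "subgroup K G" and idx: "card (rcosets K) = p"
  shows "K \<lhd> G"
proof -
  have KK: "K \<in> rcosets K"
    using K group_axioms subgroup.subgroup_in_rcosets by blast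
  have finE: "finite (rcosets K)"
    using fin by (simp add: RCOSETS_def)
  obtain b where b: "card K = p ^ b"
    using lagrange[OF K] ord divides_primepow_nat[OF p] by (metis dvd_triv_right)
  let ?S = "{C \<in> rcosets K. \<exists>r\<in>K. C #> r \<noteq> C}"
  have "?S \<subseteq> rcosets K - {K}"
    using K coset_join2 subgroup.mem_carrier[OF K] by auto
  then have "card ?S < p"
    using idx finE KK p
    by (metis (no_types, lifting) DiffE card_mono psubset_card_mono insertI1 order_le_less psubsetI subset_iff)
  moreover have "p dvd card ?S"
    by (rule p_subgroup_dvd_card_moved_rcosets[OF fin p K b K])
  ultimately have "?S = {}"
    using finE by (metis (no_types, lifting) card_eq_0_iff finite_subset mem_Collect_eq nat_dvd_not_less neq0_conv subsetI)
  then have fixed: "g \<otimes> r \<in> K #> g" if "g \<in> carrier G" "r \<in> K" for g r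
    using that rcoset_fixed_iff[OF K that(1) subgroup.mem_carrier[OF K that(2)]]
    by (auto simp: RCOSETS_def)
  show ?thesis
  proof (rule normal_invI[OF K])
    fix x h assume xh: "x \<in> carrier G" "h \<in> K"
    then show "x \<otimes> h \<otimes> inv x \<in> K"
      using fixed[OF xh] subgroup.rcos_module[OF K group_axioms, of x "x \<otimes> h"]
        subgroup.mem_carrier[OF K] by simp
  qed
qed

section \<open>Maximal subgroups and minimal normal subgroups\<close>

lemma (in group) subgroup_le_maximal:
  assumes fin: "finite (carrier G)" and K: "subgroup K G" "K \<noteq> carrier G"
  shows "\<exists>M. maximal_subgroup M G \<and> K \<subseteq> M"
proof -
  let ?S = "{L. subgroup L G \<and> K \<subseteq> L \<and> L \<noteq> carrier G}"
  have "?S \<subseteq> Pow (carrier G)"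
    by (auto dest: subgroup.subset)
  then have "finite ?S"
    using fin by (meson finite_Pow_iff finite_subset)
  moreover have "K \<in> ?S" using K by simp
  ultimately obtain M where M: "M \<in> ?S" and max: "\<forall>L\<in>?S. M \<subseteq> L \<longrightarrow> M = L"
    using finite_has_maximal[of ?S] by auto
  show ?thesis
  proof (intro exI conjI)
    show "maximal_subgroup M G"
      using M max unfolding maximal_subgroup_def by auto
    show "K \<subseteq> M"
      using M by simp
  qed
qed

lemma (in group) normal_contains_minimal_normal:
  assumes fin: "finite (carrier G)" and K: "K \<lhd> G" "K \<noteq> {\<one>}"
  shows "\<exists>N. minimal_normal N G \<and> N \<subseteq> K"
proof -
  let ?S = "{L. L \<lhd> G \<and> L \<subseteq> K \<and> L \<noteq> {\<one>}}"
  have "?S \<subseteq> Pow (carrier G)"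
    by (auto dest!: normal_imp_subgroup subgroup.subset)
  then have "finite ?S"
    using fin by (meson finite_Pow_iff finite_subset)
  moreover have "K \<in> ?S" using K by simp
  ultimately obtain N where N: "N \<in> ?S" and min: "\<forall>L\<in>?S. L \<subseteq> N \<longrightarrow> N = L"
    using finite_has_minimal[of ?S] by auto
  show ?thesis
  proof (intro exI conjI)
    show "minimal_normal N G"
      using N min unfolding minimal_normal_def by auto
    show "N \<subseteq> K"
      using N by simp
  qed
qed

section \<open>Products of a normal and a maximal subgroup, and their indices\<close>

lemma (in group) mult_normal_maximal_eq_carrier:
  assumes N: "N \<lhd> G" and M: "maximal_subgroup M G" and "\<not> N \<subseteq> M"
  shows "N <#> M = carrier G"
proof -
  have M': "subgroup M G" using M by (simp add: maximal_subgroup_def)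
  interpret second_isomorphism_grp N G M
    using N M' by (simp add: second_isomorphism_grp_def second_isomorphism_grp_axioms_def)
  show ?thesis
    using normal_set_mult_subgroup S_contained_in_set_mult H_contained_in_set_mult M assms(3)
    unfolding maximal_subgroup_def by blast
qed

lemma (in group) card_mult_normal:
  assumes N: "N \<lhd> G" and M: "subgroup M G"
    and NM: "N <#> M = carrier G"
  shows "card N * card M = order G * card (N \<inter> M)"
proof -
  interpret second_isomorphism_grp N G M
    using N M by (simp add: second_isomorphism_grp_def second_isomorphism_grp_axioms_def)
  have N': "subgroup N G" using N by (rule normal_imp_subgroup)
  have "card (rcosets\<^bsub>G\<lparr>carrier := M\<rparr>\<^esub> (N \<inter> M)) = card (rcosets N)"
    using iso_same_card[OF is_isoI[OF normal_intersection_quotient_isom]] NM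
    by (simp add: FactGroup_def)
  moreover have "card (rcosets\<^bsub>G\<lparr>carrier := M\<rparr>\<^esub> (N \<inter> M)) * card (N \<inter> M) = card M"
    using group.lagrange[OF subgroup_imp_group[OF M], of "N \<inter> M"]
      subgroup_incl[OF subgroups_Inter_pair[OF N' M] M] by (simp add: order_def)
  moreover have "card (rcosets N) * card N = order G"
    by (rule lagrange[OF N'])
  ultimately show ?thesis
    by (metis mult.assoc mult.commute)
qed

text \<open>The right-hand side does not depend on \<open>N\<close>. This lets an index condition on
  one normal subgroup be transferred to any other normal subgroup with the same supplement
  \<open>M\<close>.\<close>

lemma (in group) card_div_inter_normal:
  assumes fin: "finite (carrier G)" and N: "N \<lhd> G" and M: "subgroup M G"
    and NM: "N <#> M = carrier G"
  shows "card N div card (N \<inter> M) = order G div card M"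
proof -
  have "card M > 0" "card (N \<inter> M) > 0"
    using subgroup.finite_imp_card_positive[OF M fin]
      subgroup.finite_imp_card_positive[OF subgroups_Inter_pair[OF normal_imp_subgroup[OF N] M] fin]
    by simp_all
  have "card N div card (N \<inter> M) = (card N * card M) div (card (N \<inter> M) * card M)"
    using \<open>card M > 0\<close> by (metis div_mult_mult2 less_numeral_extra(3))
  also have "\<dots> = (order G * card (N \<inter> M)) div (card M * card (N \<inter> M))"
    by (metis card_mult_normal[OF N M NM] mult.commute)
  also have "\<dots> = order G div card M"
    using \<open>card (N \<inter> M) > 0\<close> by (metis div_mult_mult2 less_numeral_extra(3))
  finally show ?thesis .
qed

section \<open>Centralizers, conjugation and normalizers\<close>

lemma (in group) centralizer_subgroup:
  assumes "N \<subseteq> carrier G"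
  shows "subgroup {g \<in> carrier G. \<forall>n\<in>N. g \<otimes> n = n \<otimes> g} G"
proof (rule subgroupI)
  fix a b
  assume "a \<in> {g \<in> carrier G. \<forall>n\<in>N. g \<otimes> n = n \<otimes> g}" "b \<in> {g \<in> carrier G. \<forall>n\<in>N. g \<otimes> n = n \<otimes> g}"
  then show "a \<otimes> b \<in> {g \<in> carrier G. \<forall>n\<in>N. g \<otimes> n = n \<otimes> g}"
    using assms by (simp add: subset_iff m_assoc) (simp flip: m_assoc)
next
  fix a
  assume a: "a \<in> {g \<in> carrier G. \<forall>n\<in>N. g \<otimes> n = n \<otimes> g}"
  have "inv a \<otimes> n = n \<otimes> inv a" if "n \<in> N" for n
  proof -
    have n: "n \<in> carrier G" "a \<in> carrier G" "a \<otimes> n = n \<otimes> a" using that assms a by auto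
    have "inv a \<otimes> n = inv a \<otimes> (n \<otimes> a) \<otimes> inv a"
      using n(1,2) by (simp add: m_assoc)
    also have "\<dots> = n \<otimes> inv a"
      using n(1,2) by (simp flip: n(3) m_assoc)
    finally show ?thesis .
  qed
  then show "inv a \<in> {g \<in> carrier G. \<forall>n\<in>N. g \<otimes> n = n \<otimes> g}"
    using a by simp
qed (use assms in \<open>auto intro!: exI[of _ \<one>]\<close>)

lemma (in group) conj_group_hom:
  assumes "g \<in> carrier G"
  shows "group_hom G G (\<lambda>x. g \<otimes> x \<otimes> inv g)"
proof -
  have "(\<lambda>x. g \<otimes> x \<otimes> inv g) \<in> hom G G"
    by (rule homI) (use assms in \<open>auto simp: m_assoc simp flip: m_assoc[of "inv g" g]\<close>)
  then show ?thesis
    by (simp add: group_hom_def group_hom_axioms_def)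
qed

lemma (in group) conj_inj_on:
  assumes "g \<in> carrier G" "Q \<subseteq> carrier G"
  shows "inj_on (\<lambda>x. g \<otimes> x \<otimes> inv g) Q"
proof (rule inj_onI)
  fix x y assume "x \<in> Q" "y \<in> Q" "g \<otimes> x \<otimes> inv g = g \<otimes> y \<otimes> inv g"
  then show "x = y"
    using assms r_cancel[of "inv g" "g \<otimes> x" "g \<otimes> y"] by (auto simp: subset_iff)
qed

text \<open>The normalizer is described by an inclusion only. Finiteness makes conjugation by
  \<open>a\<close> a bijection of \<open>Q\<close> onto itself, which gives closure under
  inverses.\<close>

lemma (in group) normalizer_elements_subgroup:
  assumes fin: "finite (carrier G)" and Q: "Q \<subseteq> carrier G"
  shows "subgroup {g \<in> carrier G. \<forall>q\<in>Q. g \<otimes> q \<otimes> inv g \<in> Q} G"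
    (is "subgroup ?N G")
proof (rule subgroupI)
  fix a b assume ab: "a \<in> ?N" "b \<in> ?N"
  have "(a \<otimes> b) \<otimes> q \<otimes> inv (a \<otimes> b) = a \<otimes> (b \<otimes> q \<otimes> inv b) \<otimes> inv a" if "q \<in> Q" for q
    using ab that Q by (auto simp: m_assoc inv_mult_group subset_iff)
  then show "a \<otimes> b \<in> ?N" using ab by auto
next
  fix a assume a: "a \<in> ?N"
  have inj: "inj_on (\<lambda>q. a \<otimes> q \<otimes> inv a) Q"
    using conj_inj_on[OF _ Q, of a] a by simp
  have "(\<lambda>q. a \<otimes> q \<otimes> inv a) ` Q = Q"
    using endo_inj_surj[OF finite_subset[OF Q fin] _ inj] a by blast
  then have "inv a \<otimes> q \<otimes> inv (inv a) \<in> Q" if q: "q \<in> Q" for q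
  proof -
    obtain q' where q': "q' \<in> Q" "q = a \<otimes> q' \<otimes> inv a"
      using \<open>_ ` Q = Q\<close> q by auto
    then have "inv a \<otimes> q \<otimes> inv (inv a) = q'"
      using a Q by (auto simp: subset_iff m_assoc simp flip: m_assoc[of "inv a" a])
    then show ?thesis using q' by simp
  qed
  then show "inv a \<in> ?N" using a by simp
qed (use Q in \<open>auto intro!: exI[of _ \<one>]\<close>)

section \<open>Minimal normal subgroups of prime order\<close>

lemma (in group) card_rcosets_restrict:
  assumes "subgroup Y G" "subgroup Q G" "Q \<subseteq> Y"
  shows "card (rcosets\<^bsub>G\<lparr>carrier := Y\<rparr>\<^esub> Q) * card Q = card Y"
  using group.lagrange[OF subgroup_imp_group[OF assms(1)], of Q] subgroup_incl[OF assms(2,1,3)]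
  by (simp add: order_def)

text \<open>This is the Frattini argument: the conjugate of the Sylow subgroup \<open>Q\<close> by
  \<open>g\<close> is a \<open>p\<close>-subgroup of \<open>Y\<close>, so some \<open>k\<close> in
  \<open>Y\<close> conjugates it back into \<open>Q\<close>. Only this conjugate has to lie in
  \<open>Y\<close>; thus \<open>Y\<close> may also be a subgroup that is not normal.\<close>

lemma (in group) sylow_conj_normalizer:
  assumes fin: "finite (carrier G)" and p: "Factorial_Ring.prime p"
    and Y: "subgroup Y G" and Q: "subgroup Q G" "Q \<subseteq> Y" "card Q = p ^ a"
    and ndvd: "\<not> p ^ Suc a dvd card Y"
    and g: "g \<in> carrier G" "\<forall>q\<in>Q. g \<otimes> q \<otimes> inv g \<in> Y"
  shows "\<exists>k\<in>Y. k \<otimes> g \<in> {h \<in> carrier G. \<forall>q\<in>Q. h \<otimes> q \<otimes> inv h \<in> Q}"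
proof -
  let ?Y = "G\<lparr>carrier := Y\<rparr>" and ?R = "(\<lambda>q. g \<otimes> q \<otimes> inv g) ` Q"
  have YG: "group ?Y" using Y by (rule subgroup_imp_group)
  have finY: "finite (carrier ?Y)" using finite_subset[OF subgroup.subset[OF Y] fin] by simp
  have "subgroup ?R G"
    using group_hom.subgroup_img_is_subgroup[OF conj_group_hom[OF g(1)] Q(1)] .
  then have R: "subgroup ?R ?Y"
    using subgroup_incl[OF _ Y] g(2) by auto
  have cR: "card ?R = p ^ a"
    using card_image[OF conj_inj_on[OF g(1)]] Q by (simp add: subgroup.subset)
  have QY: "subgroup Q ?Y"
    by (rule subgroup_incl[OF Q(1) Y Q(2)])
  have "\<not> p dvd card (rcosets\<^bsub>?Y\<^esub> Q)"
    using card_rcosets_restrict[OF Y Q(1,2)] ndvd Q(3)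
    by (metis mult_dvd_mono dvd_refl power_Suc)
  then obtain k where k: "k \<in> Y" "\<forall>r\<in>?R. k \<otimes> r \<in> Q #> k"
    using group.p_subgroup_conj_into[OF YG finY p R cR QY] by auto
  have kG: "k \<in> carrier G" using subgroup.mem_carrier[OF Y k(1)] .
  have "(k \<otimes> g) \<otimes> q \<otimes> inv (k \<otimes> g) \<in> Q" if "q \<in> Q" for q
  proof -
    have qG: "q \<in> carrier G" using subgroup.mem_carrier[OF Q(1) that] .
    have "k \<otimes> (g \<otimes> q \<otimes> inv g) \<in> Q #> k" using k that by blast
    then have "k \<otimes> (g \<otimes> q \<otimes> inv g) \<otimes> inv k \<in> Q"
      using subgroup.rcos_module[OF Q(1) group_axioms kG, of "k \<otimes> (g \<otimes> q \<otimes> inv g)"] kG g qG by simp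
    then show ?thesis
      using kG g qG by (simp add: m_assoc inv_mult_group)
  qed
  then show ?thesis using k kG g by blast
qed

text \<open>The index hypothesis ranges over all maximal subgroups not containing \<open>N\<close>
  because it is applied twice: to one above the normalizer of a Sylow subgroup, to force
  \<open>N\<close> to be a \<open>p\<close>-group, and then to \<open>M\<close> itself.\<close>

lemma (in group) minimal_normal_prime_order:
  assumes fin: "finite (carrier G)" and N: "minimal_normal N G"
    and idx: "\<And>M. \<lbrakk>maximal_subgroup M G; \<not> N \<subseteq> M\<rbrakk>
        \<Longrightarrow> Factorial_Ring.prime (card N div card (N \<inter> M))"
    and M: "maximal_subgroup M G" "\<not> N \<subseteq> M"
  shows "N \<inter> M = {\<one>}" and "Factorial_Ring.prime (card N)"
proof -
  have Nn: "N \<lhd> G" and N1: "N \<noteq> {\<one>}"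
    and Nmin: "\<And>K. \<lbrakk>K \<lhd> G; K \<subseteq> N\<rbrakk> \<Longrightarrow> K = {\<one>} \<or> K = N"
    using N by (auto simp: minimal_normal_def)
  have Ns: "subgroup N G" using Nn by (rule normal_imp_subgroup)
  let ?N = "G\<lparr>carrier := N\<rparr>"
  have NG: "group ?N" using Ns by (rule subgroup_imp_group)
  have finN: "finite N" using finite_subset[OF subgroup.subset[OF Ns] fin] .
  have index: "card (rcosets\<^bsub>?N\<^esub> (N \<inter> M)) = card N div card (N \<inter> M)" 
    and index_dvd: "card N div card (N \<inter> M) dvd card N" if "subgroup M G" for M
  proof -
    have s: "subgroup (N \<inter> M) G" using subgroups_Inter_pair Ns that by blast
    then have "card (N \<inter> M) > 0" using subgroup.finite_imp_card_positive fin by blast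
    then show "card (rcosets\<^bsub>?N\<^esub> (N \<inter> M)) = card N div card (N \<inter> M)"
      using card_rcosets_restrict[OF Ns s] by (metis Int_lower1 div_mult_self_is_m)
    then show "card N div card (N \<inter> M) dvd card N"
      using card_rcosets_restrict[OF Ns s] by (metis Int_lower1 dvd_triv_left)
  qed
  have "card N \<noteq> 0" using finN subgroup.one_closed[OF Ns] by auto
  moreover have "card N \<noteq> 1"
    using N1 subgroup.one_closed[OF Ns] by (auto simp: card_1_singleton_iff)
  ultimately have cN: "card N > 1" by linarith
  define p where "p = Max (prime_factors (card N))"
  have ne: "prime_factors (card N) \<noteq> {}"
    using cN by (simp add: prime_factorization_empty_iff)
  have "p \<in> prime_factors (card N)"
    unfolding p_def using ne by (intro Max_in) auto
  then have p: "Factorial_Ring.prime p" "p dvd card N" by auto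
  have pmax: "q \<le> p" if "Factorial_Ring.prime q" "q dvd card N" for q
    unfolding p_def using that cN by (intro Max_ge) (auto simp: prime_factors_dvd)
  define a where "a = multiplicity p (card N)"
  have ndvd: "\<not> p ^ Suc a dvd card N"
    unfolding a_def using cN p by (subst power_dvd_iff_le_multiplicity) auto
  obtain m where m: "card N = p ^ a * m"
    using multiplicity_dvd[of p "card N"] unfolding a_def by (elim dvdE)
  have "a > 0"
    unfolding a_def using p cN by (simp add: prime_multiplicity_gt_zero_iff)
  obtain Q where Q: "subgroup Q ?N" "card Q = p ^ a"
    using sylow_thm[OF p(1) NG, of a m] m finN by (auto simp: order_def)
  have Qs: "subgroup Q G" using Q Ns incl_subgroup by blast
  have QN: "Q \<subseteq> N" using subgroup.subset[OF Q(1)] by simp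
  let ?NQ = "{h \<in> carrier G. \<forall>q\<in>Q. h \<otimes> q \<otimes> inv h \<in> Q}"
  have NQs: "subgroup ?NQ G"
    by (rule normalizer_elements_subgroup[OF fin subgroup.subset[OF Qs]])
  \<comment> \<open>A maximal \<open>M'\<close> above the normalizer of \<open>Q\<close> is refuted
    by counting the cosets of \<open>N \<inter> M'\<close> in \<open>N\<close>: their number is a
    prime divisor of \<open>card N\<close> that is 1 modulo the largest such prime.\<close>
  have "?NQ = carrier G"
  proof (rule ccontr)
    assume "?NQ \<noteq> carrier G"
    then obtain M' where M': "maximal_subgroup M' G" "?NQ \<subseteq> M'"
      using subgroup_le_maximal[OF fin NQs] by blast
    have M's: "subgroup M' G" using M' by (simp add: maximal_subgroup_def)
    have notle: "\<not> N \<subseteq> M'"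
    proof
      assume le: "N \<subseteq> M'"
      \<comment> \<open>If \<open>N\<close> were in \<open>M'\<close>, the Frattini argument in
        \<open>N\<close> would write each \<open>g\<close> as an element of \<open>N\<close> times
        one normalizing \<open>Q\<close>, both in \<open>M'\<close>.\<close>
      have "g \<in> M'" if g: "g \<in> carrier G" for g
      proof -
        have "\<forall>q\<in>Q. g \<otimes> q \<otimes> inv g \<in> N"
          using QN normal.inv_op_closed2[OF Nn g] by blast
        then obtain k where k: "k \<in> N" "k \<otimes> g \<in> ?NQ"
          using sylow_conj_normalizer[OF fin p(1) Ns Qs QN Q(2) ndvd g] by blast
        then have kM: "k \<in> M'" "k \<otimes> g \<in> M'" using le M'(2) by blast+
        then have "inv k \<otimes> (k \<otimes> g) \<in> M'"
          by (simp add: subgroup.m_closed[OF M's] subgroup.m_inv_closed[OF M's])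
        then show ?thesis
          using g subgroup.mem_carrier[OF M's kM(1)] by (simp flip: m_assoc)
      qed
      then have "M' = carrier G" using subgroup.subset[OF M's] by blast
      then show False using M'(1) by (simp add: maximal_subgroup_def)
    qed
    define q where "q = card N div card (N \<inter> M')"
    have q: "Factorial_Ring.prime q" unfolding q_def by (rule idx[OF M'(1) notle])
    have qdvd: "q dvd card N" unfolding q_def by (rule index_dvd[OF M's])
    have Ks: "subgroup (N \<inter> M') G" using subgroups_Inter_pair Ns M's by blast
    have QM: "Q \<subseteq> N \<inter> M'"
    proof -
      have "Q \<subseteq> ?NQ"
        using subgroup.mem_carrier[OF Qs]
        by (auto intro!: subgroup.m_closed[OF Qs] subgroup.m_inv_closed[OF Qs])
      then show ?thesis using QN M'(2) by blast
    qed
    have ndvdK: "\<not> p ^ Suc a dvd card (N \<inter> M')"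
      using ndvd card_rcosets_restrict[OF Ns Ks] by (metis Int_lower1 dvd_mult)
    \<comment> \<open>\<open>Q\<close> is also a Sylow subgroup of \<open>N \<inter> M'\<close>. If
      \<open>g\<close> in \<open>N\<close> conjugates \<open>Q\<close> into
      \<open>N \<inter> M'\<close>, the Frattini argument there corrects \<open>g\<close> by an
      element of \<open>M'\<close> to one normalizing \<open>Q\<close>, so \<open>g\<close> lies in
      \<open>M'\<close>. Hence \<open>Q\<close> fixes only one coset.\<close>
    have "p dvd card (rcosets\<^bsub>?N\<^esub> (N \<inter> M')) - 1"
    proof (rule group.p_subgroup_index_cong_one[OF NG _ p(1) Q])
      show "finite (carrier ?N)" using finN by simp
      show "subgroup (N \<inter> M') ?N" by (rule subgroup_incl[OF Ks Ns]) simp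
      show "Q \<subseteq> N \<inter> M'" by (rule QM)
      fix g assume "g \<in> carrier ?N" and fixed: "\<forall>r\<in>Q. g \<otimes>\<^bsub>?N\<^esub> r \<in> N \<inter> M' #>\<^bsub>?N\<^esub> g"
      then have gN: "g \<in> N" by simp
      then have g: "g \<in> carrier G" by (rule subgroup.mem_carrier[OF Ns])
      have "\<forall>q\<in>Q. g \<otimes> q \<otimes> inv g \<in> N \<inter> M'"
      proof
        fix q assume "q \<in> Q"
        then show "g \<otimes> q \<otimes> inv g \<in> N \<inter> M'"
          using fixed subgroup.rcos_module[OF Ks group_axioms g, of "g \<otimes> q"] g
            subgroup.mem_carrier[OF Qs] by simp
      qed
      then obtain k where k: "k \<in> N \<inter> M'" "k \<otimes> g \<in> ?NQ"
        using sylow_conj_normalizer[OF fin p(1) Ks Qs QM Q(2) ndvdK g] by blast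
      then have kM: "k \<in> M'" "k \<otimes> g \<in> M'" using M'(2) by blast+
      then have "inv k \<otimes> (k \<otimes> g) \<in> M'"
        by (simp add: subgroup.m_closed[OF M's] subgroup.m_inv_closed[OF M's])
      then have "g \<in> M'"
        using g subgroup.mem_carrier[OF M's kM(1)] by (simp flip: m_assoc)
      then show "g \<in> N \<inter> M'" using gN by simp
    qed
    then have "p dvd q - 1" using index[OF M's] by (simp add: q_def)
    moreover have "q - 1 > 0" using prime_gt_1_nat[OF q] by simp
    ultimately have "p \<le> q - 1" by (rule dvd_imp_le)
    then show False using pmax[OF q qdvd] \<open>q - 1 > 0\<close> by linarith
  qed
  then have "Q \<lhd> G"
    using Qs by (intro normal_invI) auto
  moreover have "Q \<noteq> {\<one>}"
    using Q(2) \<open>a > 0\<close> p(1) by (metis card_1_singleton_iff One_nat_def one_less_power prime_gt_1_nat less_irrefl)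
  ultimately have "Q = N" using Nmin QN by blast
  then have cNp: "card N = p ^ a" using Q by simp
  have Ms: "subgroup M G" using M by (simp add: maximal_subgroup_def)
  have Ks: "subgroup (N \<inter> M) G" using subgroups_Inter_pair Ns Ms by blast
  have q: "Factorial_Ring.prime (card N div card (N \<inter> M))" by (rule idx[OF M])
  have qp: "card N div card (N \<inter> M) = p"
    using q index_dvd[OF Ms] cNp p(1) by (metis prime_dvd_power primes_dvd_imp_eq)
  have KN: "N \<inter> M \<lhd> ?N"
  proof (rule group.normal_if_index_prime_p_group[OF NG _ p(1)])
    show "subgroup (N \<inter> M) ?N" by (rule subgroup_incl[OF Ks Ns]) simp
  qed (use finN cNp index[OF Ms] qp in \<open>simp_all add: order_def\<close>)
  \<comment> \<open>\<open>N\<close> normalizes \<open>N \<inter> M\<close> by \<open>KN\<close>,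
    and \<open>M\<close> normalizes it since \<open>N\<close> is normal in \<open>G\<close>;
    together they generate \<open>G\<close>.\<close>
  have "N \<inter> M \<lhd> G"
  proof (rule normal_invI[OF Ks])
    fix x h assume x: "x \<in> carrier G" and h: "h \<in> N \<inter> M"
    have "x \<in> N <#> M" using x mult_normal_maximal_eq_carrier[OF Nn M] by simp
    then obtain n m where nm: "n \<in> N" "m \<in> M" "x = n \<otimes> m" by (auto simp: set_mult_def)
    have G: "n \<in> carrier G" "m \<in> carrier G" "h \<in> carrier G"
      using nm h subgroup.mem_carrier[OF Ns] subgroup.mem_carrier[OF Ms] by auto
    have "m \<otimes> h \<otimes> inv m \<in> N \<inter> M"
      using normal.inv_op_closed2[OF Nn, of m h] h G nm
      by (simp add: subgroup.m_closed[OF Ms] subgroup.m_inv_closed[OF Ms])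
    then have "n \<otimes> (m \<otimes> h \<otimes> inv m) \<otimes> inv n \<in> N \<inter> M"
      using normal.inv_op_closed2[OF KN, of n "m \<otimes> h \<otimes> inv m"] nm m_inv_consistent[OF Ns nm(1)]
      by simp
    then show "x \<otimes> h \<otimes> inv x \<in> N \<inter> M"
      using G nm(3) by (simp add: m_assoc inv_mult_group)
  qed
  then show "N \<inter> M = {\<one>}" using Nmin[of "N \<inter> M"] M(2) by blast
  then show "Factorial_Ring.prime (card N)" using q by simp
qed

section \<open>Homomorphic images and classes of groups\<close>

lemma (in group_hom) vimage_subgroup:
  assumes "subgroup M H"
  shows "subgroup {x \<in> carrier G. h x \<in> M} G"
  by (rule G.subgroupI)
    (use subgroup.one_closed[OF assms] subgroup.m_closed[OF assms] subgroup.m_inv_closed[OF assms]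
      in \<open>auto intro!: exI[of _ \<one>]\<close>)

lemma (in group_hom) vimage_normal:
  assumes "M \<lhd> H"
  shows "{x \<in> carrier G. h x \<in> M} \<lhd> G"
  by (rule G.normal_invI[OF vimage_subgroup[OF normal_imp_subgroup[OF assms]]])
    (auto simp: normal.inv_op_closed2[OF assms])

lemma (in group_hom) vimage_image_subgroup:
  assumes K: "subgroup K G" and ker: "kernel G H h \<subseteq> K"
  shows "{x \<in> carrier G. h x \<in> h ` K} = K"
proof
  show "K \<subseteq> {x \<in> carrier G. h x \<in> h ` K}"
    using subgroup.subset[OF K] by auto
  show "{x \<in> carrier G. h x \<in> h ` K} \<subseteq> K"
  proof clarify
    fix x k assume x: "x \<in> carrier G" and k: "k \<in> K" "h x = h k"
    have kG: "k \<in> carrier G" by (rule subgroup.mem_carrier[OF K k(1)])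
    have "h (x \<otimes> inv k) = \<one>\<^bsub>H\<^esub>" using x k kG by simp
    then have "x \<otimes> inv k \<in> K" using ker x kG by (auto simp: kernel_def)
    then have "x \<otimes> inv k \<otimes> k \<in> K" by (rule subgroup.m_closed[OF K _ k(1)])
    then show "x \<in> K" using x kG by (simp add: G.m_assoc)
  qed
qed

lemma (in group_hom) vimage_maximal:
  assumes surj: "h ` carrier G = carrier H" and M: "maximal_subgroup M H"
  shows "maximal_subgroup {x \<in> carrier G. h x \<in> M} G"
proof -
  let ?V = "{x \<in> carrier G. h x \<in> M}"
  have Ms: "subgroup M H" and "M \<noteq> carrier H" using M by (auto simp: maximal_subgroup_def)
  have img: "h ` ?V = M"
  proof
    show "M \<subseteq> h ` ?V" 
    proof
      fix y assume y: "y \<in> M"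
      then have "y \<in> h ` carrier G" using surj subgroup.subset[OF Ms] by auto
      then show "y \<in> h ` ?V" using y by auto
    qed
  qed auto
  have "?V \<noteq> carrier G" using img surj \<open>M \<noteq> carrier H\<close> by metis
  moreover have "K = ?V \<or> K = carrier G" if K: "subgroup K G" "?V \<subseteq> K" for K
  proof -
    have "subgroup (h ` K) H" using K(1) by (rule subgroup_img_is_subgroup)
    moreover have "M \<subseteq> h ` K" using img K(2) by blast
    ultimately have cases: "h ` K = M \<or> h ` K = carrier H" using M by (auto simp: maximal_subgroup_def)
    have "kernel G H h \<subseteq> K" using K(2) subgroup.one_closed[OF Ms] by (auto simp: kernel_def)
    then have "K = {x \<in> carrier G. h x \<in> h ` K}" using vimage_image_subgroup[OF K(1)] by simp
    then show ?thesis using cases by auto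
  qed
  ultimately show ?thesis
    using vimage_subgroup[OF Ms] by (simp add: maximal_subgroup_def)
qed

lemma (in group_hom) image_maximal:
  assumes surj: "h ` carrier G = carrier H" and M: "maximal_subgroup M G"
    and ker: "kernel G H h \<subseteq> M"
  shows "maximal_subgroup (h ` M) H"
proof -
  have Ms: "subgroup M G" and "M \<noteq> carrier G" using M by (auto simp: maximal_subgroup_def)
  have M_eq: "{x \<in> carrier G. h x \<in> h ` M} = M" by (rule vimage_image_subgroup[OF Ms ker])
  have "h ` M \<noteq> carrier H" using M_eq \<open>M \<noteq> carrier G\<close> by auto
  moreover have "K = h ` M \<or> K = carrier H" if K: "subgroup K H" "h ` M \<subseteq> K" for K
  proof -
    let ?V = "{x \<in> carrier G. h x \<in> K}"
    have "K \<subseteq> h ` ?V" 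
    proof
      fix y assume y: "y \<in> K"
      then have "y \<in> h ` carrier G" using surj subgroup.subset[OF K(1)] by auto
      then show "y \<in> h ` ?V" using y by auto
    qed
    then have img: "h ` ?V = K" by auto
    have "M \<subseteq> ?V" using subgroup.subset[OF Ms] K(2) by auto
    then have "?V = M \<or> ?V = carrier G"
      using M vimage_subgroup[OF K(1)] unfolding maximal_subgroup_def by simp
    then show ?thesis using img surj by metis
  qed
  ultimately show ?thesis
    using subgroup_img_is_subgroup[OF Ms] by (simp add: maximal_subgroup_def)
qed

lemma (in normal) rcos_group_hom: "group_hom G (G Mod H) (\<lambda>x. H #> x)"
  by (simp add: group_hom_def group_hom_axioms_def factorgroup_is_group r_coset_hom_Mod)

lemma (in normal) kernel_rcos: "kernel G (G Mod H) (\<lambda>x. H #> x) = H"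
  using coset_join1[OF _ _ subgroup_axioms] coset_join2[OF _ subgroup_axioms]
  by (auto simp: kernel_def)

text \<open>The first isomorphism theorem for \<open>h\<close> followed by the projection modulo
  \<open>N\<close>. It covers both transport along isomorphisms and quotients of quotients.\<close>

lemma (in group_hom) FactGroup_vimage_iso:
  assumes surj: "h ` carrier G = carrier H" and N: "N \<lhd> H"
  shows "G Mod {x \<in> carrier G. h x \<in> N} \<cong> H Mod N"
proof -
  interpret N: normal N H by (rule N)
  let ?f = "(\<lambda>y. N #>\<^bsub>H\<^esub> y) \<circ> h"
  interpret f: group_hom G "H Mod N" ?f
    unfolding group_hom_def group_hom_axioms_def
    using Group.hom_compose[OF homh N.r_coset_hom_Mod] N.factorgroup_is_group by simp
  have "kernel G (H Mod N) ?f = {x \<in> carrier G. h x \<in> N}"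
    using N.kernel_rcos by (auto simp: kernel_def)
  moreover have "?f ` carrier G = carrier (H Mod N)"
    by (simp only: image_comp[symmetric] surj carrier_FactGroup)
  ultimately show ?thesis
    using f.FactGroup_iso by simp
qed

section \<open>Transport of class membership between carrier types\<close>

lemma (in group) nat_copy_exists:
  assumes "finite (carrier G)"
  shows "\<exists>(Y :: nat monoid) f. group Y \<and> finite (carrier Y) \<and> f \<in> iso G Y"
proof -
  obtain f :: "'a \<Rightarrow> nat" where f: "inj_on f (carrier G)"
    using assms finite_imp_inj_to_nat_seg by blast
  define g where "g = the_inv_into (carrier G) f"
  have gf: "g (f x) = x" if "x \<in> carrier G" for x
    unfolding g_def using the_inv_into_f_f[OF f that] .
  \<comment> \<open>The multiplication is carried over along an injection \<open>f\<close> of the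
    finite carrier into the natural numbers, with \<open>g\<close> as its inverse. Such copies are
    needed because classes and formations are specified on \<open>nat\<close> only.\<close>
  define Y where "Y = \<lparr>carrier = f ` carrier G, monoid.mult = (\<lambda>x y. f (g x \<otimes> g y)), one = f \<one>\<rparr>"
  have hom: "f \<in> hom G Y"
    by (rule homI) (auto simp: Y_def gf)
  have "group Y"
    using hom_imp_img_group[OF hom] by (simp add: Y_def)
  moreover have "f \<in> iso G Y"
    using hom f by (simp add: iso_def bij_betw_def Y_def)
  moreover have "finite (carrier Y)"
    using assms by (simp add: Y_def)
  ultimately show ?thesis by blast
qed

text \<open>That \<open>K\<close> is a group is a separate assumption because \<open>\<cong>\<close>
  speaks of carriers and multiplication only and leaves the \<open>one\<close> field of
  \<open>K\<close> unconstrained.\<close>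

lemma in_class_iso:
  assumes "in_class F G" "G \<cong> K" "group K"
  shows "in_class F K"
proof -
  obtain Y where Y: "F Y" "group Y" "finite (carrier Y)" "G \<cong> Y" and G: "group G" "finite (carrier G)"
    using assms(1) by (auto simp: in_class_def)
  have "K \<cong> Y" using iso_trans[OF group.iso_sym[OF G(1) assms(2)] Y(4)] .
  moreover have "finite (carrier K)" using iso_finite[OF assms(2)] G(2) by simp
  ultimately show ?thesis
    using Y assms(3) unfolding in_class_def by blast
qed

lemma in_class_Mod_iso_iff:
  assumes Y: "group Y" and G: "group G" and f: "f \<in> iso G Y" and N: "N \<lhd> G"
  shows "f ` N \<lhd> Y" and "in_class F (Y Mod f ` N) \<longleftrightarrow> in_class F (G Mod N)"
proof -
  interpret f: group_hom G Y f
    using f Y G by (simp add: group_hom_def group_hom_axioms_def iso_def)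
  show N': "f ` N \<lhd> Y" by (rule iso_normal_subgroup[OF f G Y N])
  have surj: "f ` carrier G = carrier Y"
    using f by (simp add: iso_def bij_betw_def)
  have "inj_on f (carrier G)" using f by (simp add: iso_def bij_betw_def)
  then have "kernel G Y f = {\<one>\<^bsub>G\<^esub>}" using f.inj_iff_trivial_ker by simp
  then have "kernel G Y f \<subseteq> N" using subgroup.one_closed[OF normal_imp_subgroup[OF N]] by simp
  then have "{x \<in> carrier G. f x \<in> f ` N} = N"
    using f.vimage_image_subgroup[OF normal_imp_subgroup[OF N]] by simp
  then have iso: "G Mod N \<cong> Y Mod f ` N"
    using f.FactGroup_vimage_iso[OF surj N'] by simp
  have gr: "group (G Mod N)" "group (Y Mod f ` N)"
    using N N' by (simp_all add: normal.factorgroup_is_group)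
  show "in_class F (Y Mod f ` N) \<longleftrightarrow> in_class F (G Mod N)"
    using in_class_iso[OF _ iso gr(2)] in_class_iso[OF _ group.iso_sym[OF gr(1) iso] gr(1)] by blast
qed

text \<open>Extends the first closure property of a formation from \<open>nat\<close> to any carrier
  type, by passing to an isomorphic copy.\<close>

lemma formation_quotient:
  assumes F: "formation F" and G: "in_class F G" and N: "N \<lhd> G"
  shows "in_class F (G Mod N)"
proof -
  have gG: "group G" and fG: "finite (carrier G)" using G by (auto simp: in_class_def)
  obtain Y :: "nat monoid" and f where Y: "group Y" "finite (carrier Y)" "f \<in> iso G Y"
    using group.nat_copy_exists[OF gG fG] by blast
  have "in_class F Y" by (rule in_class_iso[OF G is_isoI[OF Y(3)] Y(1)])
  then have "in_class F (Y Mod f ` N)"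
    using F Y in_class_Mod_iso_iff(1)[OF Y(1) gG Y(3) N] unfolding formation_def by blast
  then show ?thesis using in_class_Mod_iso_iff(2)[OF Y(1) gG Y(3) N] by blast
qed

text \<open>By the third isomorphism theorem the quotient by \<open>K\<close> is a quotient of the
  quotient by \<open>P\<close>.\<close>

lemma formation_quotient_mono:
  assumes F: "formation F" and G: "group G" and P: "P \<lhd> G" "in_class F (G Mod P)"
    and K: "K \<lhd> G" "P \<subseteq> K"
  shows "in_class F (G Mod K)"
proof -
  interpret P: normal P G by (rule P)
  interpret h: group_hom G "G Mod P" "\<lambda>x. P #>\<^bsub>G\<^esub> x" by (rule P.rcos_group_hom)
  let ?K = "(\<lambda>x. P #>\<^bsub>G\<^esub> x) ` K"
  have surj: "(\<lambda>x. P #>\<^bsub>G\<^esub> x) ` carrier G = carrier (G Mod P)"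
    by (simp add: carrier_FactGroup)
  have K': "?K \<lhd> G Mod P"
    by (rule normal.surj_hom_normal_subgroup[OF K(1) h.group_hom_axioms surj])
  have "{x \<in> carrier G. P #>\<^bsub>G\<^esub> x \<in> ?K} = K"
    by (rule h.vimage_image_subgroup[OF normal_imp_subgroup[OF K(1)]]) (simp add: P.kernel_rcos K(2))
  then have iso: "G Mod K \<cong> (G Mod P) Mod ?K"
    using h.FactGroup_vimage_iso[OF surj K'] by simp
  have gK: "group (G Mod K)" using K(1) by (rule normal.factorgroup_is_group)
  show ?thesis
    by (rule in_class_iso[OF formation_quotient[OF F P(2) K'] group.iso_sym[OF gK iso] gK])
qed

lemma formation_inter:
  assumes F: "formation F" and G: "group G" "finite (carrier G)"
    and N: "N1 \<lhd> G" "N2 \<lhd> G" "in_class F (G Mod N1)" "in_class F (G Mod N2)"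
  shows "in_class F (G Mod (N1 \<inter> N2))"
proof -
  obtain Y :: "nat monoid" and f where Y: "group Y" "finite (carrier Y)" "f \<in> iso G Y"
    using group.nat_copy_exists[OF G] by blast
  note tr = in_class_Mod_iso_iff[OF Y(1) G(1) Y(3)]
  have inj: "inj_on f (carrier G)" using Y(3) by (simp add: iso_def bij_betw_def)
  have img: "f ` (N1 \<inter> N2) = f ` N1 \<inter> f ` N2"
    using inj_on_image_Int[OF inj] subgroup.subset[OF normal_imp_subgroup[OF N(1)]]
      subgroup.subset[OF normal_imp_subgroup[OF N(2)]] by blast
  have "in_class F (Y Mod (f ` N1 \<inter> f ` N2))"
    using F Y tr(1)[OF N(1)] tr(1)[OF N(2)] tr(2)[OF N(1)] tr(2)[OF N(2)] N(3,4)
    unfolding formation_def by blast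
  then show ?thesis
    using tr(2)[OF group.normal_subgroup_intersect[OF G(1) N(1,2)]] by (simp add: img)
qed

section \<open>Self-centralizing normal subgroups of prime order\<close>

lemma (in group) prime_order_subgroup_powers:
  assumes fin: "finite (carrier G)" and N: "subgroup N G" and p: "Factorial_Ring.prime (card N)"
    and z: "z \<in> N" "z \<noteq> \<one>"
  shows "ord z = card N" and "N = {z [^] k | k. k \<in> (UNIV :: nat set)}"
proof -
  have zG: "z \<in> carrier G" by (rule subgroup.mem_carrier[OF N z(1)])
  have finN: "finite N" using finite_subset[OF subgroup.subset[OF N] fin] .
  have sub: "generate G {z} \<subseteq> N"
    using generate_subgroup_incl[OF _ N] z(1) by simp
  have gs: "subgroup (generate G {z}) G"
    using generate_is_subgroup[of "{z}"] zG by simp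
  have "card (generate G {z}) dvd card N"
    using card_rcosets_restrict[OF N gs sub] by (metis dvd_triv_right)
  then have "ord z dvd card N" using generate_pow_card[OF zG] by simp
  moreover have "ord z \<noteq> 1" using ord_eq_1[OF zG] z(2) by simp
  ultimately show o: "ord z = card N" using p by (auto simp: prime_nat_iff)
  have "generate G {z} = N"
    using card_subset_eq[OF finN sub] o generate_pow_card[OF zG] by simp
  then show "N = {z [^] k | k. k \<in> (UNIV :: nat set)}"
    using generate_pow_on_finite_carrier[OF fin zG] by simp
qed

lemma (in group) conj_nat_pow:
  assumes "u \<in> carrier G" "x \<in> carrier G"
  shows "u \<otimes> x [^] (k :: nat) \<otimes> inv u = (u \<otimes> x \<otimes> inv u) [^] k"
  using group_hom.hom_nat_pow[OF conj_group_hom[OF assms(1)] assms(2)] .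

text \<open>Conjugation embeds \<open>G/N\<close> into the cyclic group of units modulo \<open>p\<close>; the generator of
  the image is an element inducing the least positive exponent of a primitive root.\<close>

lemma (in group) cyclic_FactGroup_prime_self_centralizing:
  assumes fin: "finite (carrier G)" and N: "N \<lhd> G" and p: "Factorial_Ring.prime (card N)"
    and cent: "{g \<in> carrier G. \<forall>n\<in>N. g \<otimes> n = n \<otimes> g} \<subseteq> N"
  shows "cyclic_group (G Mod N)"
proof -
  let ?p = "card N"
  have Ns: "subgroup N G" using N by (rule normal_imp_subgroup)
  have "\<exists>z\<in>N. z \<noteq> \<one>"
  proof (rule ccontr)
    assume "\<not> ?thesis"
    then have "N \<subseteq> {\<one>}" by auto
    then have "card N \<le> 1" using card_mono[of "{\<one>}" N] by simp
    then show False using prime_gt_1_nat[OF p] by simp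
  qed
  then obtain z where z: "z \<in> N" "z \<noteq> \<one>" by blast
  have zG: "z \<in> carrier G" by (rule subgroup.mem_carrier[OF Ns z(1)])
  have ord: "ord z = ?p" and pow: "N = {z [^] k | k. k \<in> (UNIV :: nat set)}"
    using prime_order_subgroup_powers[OF fin Ns p z] by auto
  \<comment> \<open>Exponents of \<open>z\<close> matter only modulo its order, which is the prime
    \<open>?p\<close>.\<close>
  have cong: "z [^] (i::nat) = z [^] j" if "[i = j] (mod ?p)" for i j
  proof -
    have "z [^] i = z [^] (i mod ?p)" for i :: nat
    proof -
      have "z [^] i = z [^] (?p * (i div ?p) + i mod ?p)" by simp
      also have "\<dots> = (z [^] ?p) [^] (i div ?p) \<otimes> z [^] (i mod ?p)"
        using zG by (simp only: nat_pow_mult[symmetric] nat_pow_pow)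
      also have "z [^] ?p = \<one>" using pow_ord_eq_1[OF zG] ord by simp
      finally show ?thesis using zG by simp
    qed
    then show ?thesis using that by (metis cong_def)
  qed
  obtain a where a: "a \<in> {1..?p - 1}" "{1..?p - 1} = {a ^ i mod ?p | i. i \<in> UNIV}"
    using residue_prime_mult_group_has_gen[OF p] by blast
  \<comment> \<open>A conjugate of \<open>z\<close> is a power of \<open>z\<close> whose exponent is
    nonzero modulo \<open>?p\<close>, as \<open>z\<close> is not the identity; such an exponent is a
    power of the primitive root \<open>a\<close>.\<close>
  have expo: "\<exists>e. y \<otimes> z \<otimes> inv y = z [^] (a ^ e)" if y: "y \<in> carrier G" for y
  proof -
    have "y \<otimes> z \<otimes> inv y \<in> N" using normal.inv_op_closed2[OF N y z(1)] .
    then obtain k :: nat where k: "y \<otimes> z \<otimes> inv y = z [^] k" using pow by blast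
    have "k mod ?p \<noteq> 0"
    proof
      assume "k mod ?p = 0"
      then have "[k = 0] (mod ?p)" by (simp add: cong_def)
      then have "y \<otimes> z \<otimes> inv y = \<one>" using cong k by fastforce
      then have "z = \<one>" using y zG by (metis inv_solve_right' l_cancel_one l_one one_closed m_closed)
      then show False using z(2) by simp
    qed
    then have "k mod ?p \<in> {1..?p - 1}"
      using mod_less_divisor[OF prime_gt_0_nat[OF p], of k] by simp
    then have "k mod ?p \<in> {a ^ i mod ?p | i. i \<in> UNIV}" by (simp only: a(2))
    then obtain e where "k mod ?p = a ^ e mod ?p" by blast
    then show ?thesis using cong[of k "a ^ e"] k by (auto simp: cong_def)
  qed
  \<comment> \<open>The positive exponents of \<open>a\<close> that are realized by conjugation. By
    Fermat, \<open>?p - 1\<close> is one of them, realized by the identity, so a least one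
    exists.\<close>
  let ?S = "\<lambda>e. 0 < e \<and> (\<exists>x\<in>carrier G. x \<otimes> z \<otimes> inv x = z [^] (a ^ e))"
  have "\<not> ?p dvd a" using a(1) by (auto dest: dvd_imp_le)
  then have "z [^] (a ^ (?p - 1)) = z"
    using cong[OF fermat_theorem[OF p]] zG by simp
  then have "?S (?p - 1)"
    using zG prime_gt_1_nat[OF p] by (intro conjI bexI[of _ \<one>]) auto
  define d where "d = (LEAST e. ?S e)"
  have "?S d" unfolding d_def by (rule LeastI[of ?S, OF \<open>?S (?p - 1)\<close>])
  then obtain x where d: "0 < d" and x: "x \<in> carrier G" "x \<otimes> z \<otimes> inv x = z [^] (a ^ d)" by blast
  have xpow: "x [^] q \<otimes> z \<otimes> inv (x [^] q) = z [^] (a ^ (d * q))" for q :: nat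
  proof (induction q)
    case 0
    then show ?case using zG by simp
  next
    case (Suc q)
    have "x [^] Suc q \<otimes> z \<otimes> inv (x [^] Suc q) = x [^] q \<otimes> (x \<otimes> z \<otimes> inv x) \<otimes> inv (x [^] q)"
      using x(1) zG by (simp add: inv_mult_group m_assoc)
    also have "\<dots> = (x [^] q \<otimes> z \<otimes> inv (x [^] q)) [^] (a ^ d)"
      using x zG by (simp add: conj_nat_pow)
    also have "\<dots> = z [^] (a ^ (d * Suc q))"
      using zG Suc by (simp add: nat_pow_pow power_add mult.commute)
    finally show ?case .
  qed
  have gen: "\<exists>k::int. y \<in> N #> (x [^] k)" if y: "y \<in> carrier G" for y
  proof -
    obtain e where e: "y \<otimes> z \<otimes> inv y = z [^] (a ^ e)" using expo[OF y] by blast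
    \<comment> \<open>Division with remainder by \<open>d\<close>: removing the power
      \<open>u\<close> of \<open>x\<close> from \<open>y\<close> leaves \<open>w\<close>, which
      realizes \<open>e mod d\<close>. Minimality of \<open>d\<close> makes this 0, so
      \<open>w\<close> centralizes \<open>N\<close> and therefore lies in \<open>N\<close>.\<close>
    define u w where "u = x [^] (e div d)" and "w = inv u \<otimes> y"
    have uG: "u \<in> carrier G" using x by (simp add: u_def)
    have wG: "w \<in> carrier G" using uG y by (simp add: w_def)
    have "w \<otimes> z \<otimes> inv w = inv u \<otimes> (y \<otimes> z \<otimes> inv y) \<otimes> u"
      using uG y zG by (simp add: w_def inv_mult_group m_assoc)
    also have "\<dots> = inv u \<otimes> (u \<otimes> z \<otimes> inv u) [^] (a ^ (e mod d)) \<otimes> u"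
    proof -
      have "a ^ e = a ^ (d * (e div d)) * a ^ (e mod d)"
        by (simp flip: power_add)
      then show ?thesis
        using zG by (simp add: e u_def xpow nat_pow_pow)
    qed
    also have "\<dots> = inv u \<otimes> (u \<otimes> z [^] (a ^ (e mod d)) \<otimes> inv u) \<otimes> u"
      using uG zG by (simp add: conj_nat_pow)
    also have "\<dots> = z [^] (a ^ (e mod d))"
      using uG zG by (simp add: m_assoc) (simp flip: m_assoc)
    finally have w: "w \<otimes> z \<otimes> inv w = z [^] (a ^ (e mod d))" .
    have "e mod d = 0"
    proof (rule ccontr)
      assume "e mod d \<noteq> 0"
      then have "?S (e mod d)" using w wG by blast
      then have "d \<le> e mod d" unfolding d_def by (rule Least_le)
      then show False using mod_less_divisor[OF d, of e] by simp
    qed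
    then have wz: "w \<otimes> z \<otimes> inv w = z" using w zG by simp
    have "w \<otimes> n = n \<otimes> w" if nN: "n \<in> N" for n
    proof -
      obtain k :: nat where n: "n = z [^] k" using nN pow by blast
      then have "w \<otimes> n \<otimes> inv w = n" using conj_nat_pow[OF wG zG, of k] wz by simp
      then have "w \<otimes> n \<otimes> inv w \<otimes> w = n \<otimes> w" by simp
      then show ?thesis using wG zG n by (simp add: m_assoc)
    qed
    then have "w \<in> N" using cent wG by blast
    then have "u \<otimes> w \<in> u <# N" by (auto simp: l_coset_def)
    then have "y \<in> u <# N" using uG y by (simp add: w_def flip: m_assoc)
    then have "y \<in> N #> u" using normal.coset_eq[OF N] uG by simp
    then have "y \<in> N #> (x [^] int (e div d))" by (simp add: u_def int_pow_int)
    then show ?thesis by blast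
  qed
  interpret Q: group "G Mod N" using N by (rule normal.factorgroup_is_group)
  have "carrier (G Mod N) \<subseteq> range (\<lambda>k::int. (N #> x) [^]\<^bsub>G Mod N\<^esub> k)"
  proof
    fix C assume "C \<in> carrier (G Mod N)"
    then obtain y where y: "y \<in> carrier G" "C = N #> y" by (auto simp: carrier_FactGroup)
    then obtain k :: int where "y \<in> N #> (x [^] k)" using gen by blast
    then have "C = N #> (x [^] k)"
      using y(2) repr_independence[OF _ _ Ns, of y "x [^] k"] x(1) by simp
    then show "C \<in> range (\<lambda>k::int. (N #> x) [^]\<^bsub>G Mod N\<^esub> k)"
      using normal.FactGroup_int_pow[OF N x(1)] by blast
  qed
  moreover have xN: "N #> x \<in> carrier (G Mod N)" using x(1) by (auto simp: carrier_FactGroup)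
  ultimately show ?thesis
    unfolding Q.cyclic_group by (intro bexI[of _ "N #> x"]) auto
qed

lemma (in group) prime_order_cyclic:
  assumes fin: "finite (carrier G)" and p: "Factorial_Ring.prime (order G)"
  shows "cyclic_group G"
proof -
  have "\<exists>z\<in>carrier G. z \<noteq> \<one>"
  proof (rule ccontr)
    assume "\<not> ?thesis"
    then have "carrier G \<subseteq> {\<one>}" by auto
    then have "order G \<le> 1" using card_mono[of "{\<one>}" "carrier G"] by (simp add: order_def)
    then show False using prime_gt_1_nat[OF p] by simp
  qed
  then obtain z where z: "z \<in> carrier G" "z \<noteq> \<one>" by blast
  have "carrier G = {z [^] k | k. k \<in> (UNIV :: nat set)}"
    by (rule prime_order_subgroup_powers(2)[OF fin subgroup_self _ z]) (use p in \<open>simp add: order_def\<close>)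
  then have "carrier G = {z [^] k | k. k \<in> (UNIV :: int set)}"
    using generate_pow_on_finite_carrier[OF fin z(1)] generate_pow[OF z(1)] by simp
  then have "carrier G = range (\<lambda>k::int. z [^] k)"
    by (simp add: full_SetCompr_eq)
  then show ?thesis unfolding cyclic_group using z(1) by blast
qed

text \<open>The normal chain is the trivial subgroup, \<open>N\<close>, \<open>carrier G\<close>:
  its lower factor has prime order, and its upper factor is cyclic by the embedding into the units
  modulo a prime.\<close>

lemma (in group) supersoluble_if_prime_self_centralizing:
  assumes fin: "finite (carrier G)" and N: "N \<lhd> G" and p: "Factorial_Ring.prime (card N)"
    and cent: "{g \<in> carrier G. \<forall>n\<in>N. g \<otimes> n = n \<otimes> g} \<subseteq> N"
  shows "supersoluble G"
proof -
  have Ns: "subgroup N G" using N by (rule normal_imp_subgroup)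
  interpret N: group "G\<lparr>carrier := N\<rparr>" using Ns by (rule subgroup_imp_group)
  have "cyclic_group (G\<lparr>carrier := N\<rparr>)"
    by (rule N.prime_order_cyclic)
      (use p finite_subset[OF subgroup.subset[OF Ns] fin] in \<open>simp_all add: order_def\<close>)
  moreover have "G\<lparr>carrier := N\<rparr> Mod {\<one>} \<cong> G\<lparr>carrier := N\<rparr>"
    using is_isoI[OF N.trivial_factor_iso] by simp
  moreover have "group (G\<lparr>carrier := N\<rparr> Mod {\<one>})"
    using normal.factorgroup_is_group[OF N.one_is_normal] by simp
  ultimately have c1: "cyclic_group (G\<lparr>carrier := N\<rparr> Mod {\<one>})"
    using isomorphic_group_cyclicity N.group_axioms by blast
  have c2: "cyclic_group (G\<lparr>carrier := carrier G\<rparr> Mod N)"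
    using cyclic_FactGroup_prime_self_centralizing[OF fin N p cent] by simp
  have "carrier G \<lhd> G"
    by (rule normal_invI[OF subgroup_self]) auto
  then show ?thesis
    unfolding supersoluble_def
    using c1 c2 one_is_normal N subgroup.one_closed[OF Ns] subgroup.subset[OF Ns] group_axioms
    by (intro conjI exI[of _ "[{\<one>}, N, carrier G]"]) (auto simp: less_Suc_eq nth_Cons')
qed

section \<open>Frattini subgroup and socle of a normal subgroup\<close>

lemma (in group) frattini_subgroup: "subgroup (frattini G) G"
proof -
  \<comment> \<open>Inserting \<open>carrier G\<close> keeps the intersected family nonempty even if
    there are no maximal subgroups.\<close>
  have "frattini G = \<Inter> (insert (carrier G) {M. maximal_subgroup M G})"
    by (auto simp: frattini_def)
  moreover have "subgroup (\<Inter> (insert (carrier G) {M. maximal_subgroup M G})) G"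
    by (rule subgroups_Inter) (auto simp: maximal_subgroup_def subgroup_self)
  ultimately show ?thesis by simp
qed

lemma (in group_hom) frattini_image:
  assumes surj: "h ` carrier G = carrier H" and x: "x \<in> frattini G"
  shows "h x \<in> frattini H"
  using x vimage_maximal[OF surj] unfolding frattini_def by auto

text \<open>Elements of \<open>G\<close> induce automorphisms of \<open>H\<close>. This yields
  normality in \<open>G\<close> of the Frattini subgroup and the socle of \<open>H\<close>, which
  are characteristic in \<open>H\<close>.\<close>

lemma (in normal) conj_restrict:
  assumes g: "g \<in> carrier G"
  shows "group_hom (G\<lparr>carrier := H\<rparr>) (G\<lparr>carrier := H\<rparr>) (\<lambda>x. g \<otimes> x \<otimes> inv g)"
    and "(\<lambda>x. g \<otimes> x \<otimes> inv g) ` H = H"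
proof -
  interpret c: group_hom G G "\<lambda>x. g \<otimes> x \<otimes> inv g" by (rule conj_group_hom[OF g])
  show img: "(\<lambda>x. g \<otimes> x \<otimes> inv g) ` H = H"
  proof
    show "(\<lambda>x. g \<otimes> x \<otimes> inv g) ` H \<subseteq> H" using inv_op_closed2[OF g] by auto
    show "H \<subseteq> (\<lambda>x. g \<otimes> x \<otimes> inv g) ` H"
    proof
      fix x assume x: "x \<in> H"
      have "x = g \<otimes> (inv g \<otimes> x \<otimes> g) \<otimes> inv g"
        using g x by (simp add: m_assoc) (simp flip: m_assoc)
      then show "x \<in> (\<lambda>x. g \<otimes> x \<otimes> inv g) ` H" using inv_op_closed1[OF g x] by blast
    qed
  qed
  show "group_hom (G\<lparr>carrier := H\<rparr>) (G\<lparr>carrier := H\<rparr>) (\<lambda>x. g \<otimes> x \<otimes> inv g)"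
    using c.induced_group_hom[OF subgroup_axioms] by (simp add: img)
qed

lemma (in normal) frattini_normal: "frattini (G\<lparr>carrier := H\<rparr>) \<lhd> G"
proof (rule normal_invI)
  show "subgroup (frattini (G\<lparr>carrier := H\<rparr>)) G"
    by (rule incl_subgroup[OF subgroup_axioms group.frattini_subgroup[OF subgroup_imp_group[OF subgroup_axioms]]])
  fix x h assume "x \<in> carrier G" "h \<in> frattini (G\<lparr>carrier := H\<rparr>)"
  then show "x \<otimes> h \<otimes> inv x \<in> frattini (G\<lparr>carrier := H\<rparr>)"
    using group_hom.frattini_image[OF conj_restrict(1)] conj_restrict(2) by simp
qed

lemma (in group) frattini_self_normal: "frattini G \<lhd> G"
proof -
  have "carrier G \<lhd> G" by (rule normal_invI[OF subgroup_self]) auto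
  then show ?thesis using normal.frattini_normal by fastforce
qed

text \<open>If a maximal \<open>M\<close> did not contain the Frattini subgroup \<open>?P\<close> of
  \<open>H\<close>, then \<open>G\<close> would be the product of \<open>?P\<close> and
  \<open>M\<close>, and Dedekind's law would make \<open>H\<close> the product of \<open>?P\<close>
  and \<open>H \<inter> M\<close>. But both factors lie in a common maximal subgroup
  \<open>K\<close> of \<open>H\<close>.\<close>

lemma (in normal) frattini_mono:
  assumes fin: "finite (carrier G)"
  shows "frattini (G\<lparr>carrier := H\<rparr>) \<subseteq> frattini G"
proof -
  let ?H = "G\<lparr>carrier := H\<rparr>"
  let ?P = "frattini ?H"
  have HG: "group ?H" by (rule subgroup_imp_group[OF subgroup_axioms])
  have PH: "?P \<subseteq> H" by (auto simp: frattini_def)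
  have "?P \<subseteq> M" if M: "maximal_subgroup M G" for M
  proof (rule ccontr)
    assume nle: "\<not> ?P \<subseteq> M"
    have Ms: "subgroup M G" using M by (simp add: maximal_subgroup_def)
    have PM: "?P <#> M = carrier G" by (rule mult_normal_maximal_eq_carrier[OF frattini_normal M nle])
    have HMs: "subgroup (H \<inter> M) ?H"
      by (rule subgroup_incl[OF subgroups_Inter_pair[OF subgroup_axioms Ms] subgroup_axioms]) simp
    have "H \<inter> M \<noteq> H" using nle PH by blast
    then obtain K where K: "maximal_subgroup K ?H" "H \<inter> M \<subseteq> K"
      using group.subgroup_le_maximal[OF HG _ HMs] finite_subset[OF subset fin] by auto
    have Ks: "subgroup K ?H" using K by (simp add: maximal_subgroup_def)
    have PK: "?P \<subseteq> K" using K(1) by (auto simp: frattini_def)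
    have "H \<subseteq> K"
    proof
      fix x assume x: "x \<in> H"
      then have "x \<in> ?P <#> M" using PM by simp
      then obtain q m where qm: "q \<in> ?P" "m \<in> M" "x = q \<otimes> m" by (auto simp: set_mult_def)
      have G: "q \<in> H" "m \<in> carrier G" using qm PH subgroup.mem_carrier[OF Ms] by auto
      then have "m = inv q \<otimes> x" using qm(3) by (simp flip: m_assoc)
      then have "m \<in> H" using G x by simp
      then have "q \<otimes>\<^bsub>?H\<^esub> m \<in> K" using qm K(2) PK by (intro subgroup.m_closed[OF Ks]) auto
      then show "x \<in> K" using qm(3) by simp
    qed
    then show False using K(1) subgroup.subset[OF Ks] by (simp add: maximal_subgroup_def)
  qed
  then show ?thesis using PH subset by (auto simp: frattini_def)
qed

section \<open>The socle of a normal subgroup, centralizers and counting over cosets\<close>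

lemma (in group_hom) iso_image_minimal_normal:
  assumes bij: "bij_betw h (carrier G) (carrier H)" and N: "minimal_normal N G"
  shows "minimal_normal (h ` N) H"
proof -
  have surj: "h ` carrier G = carrier H" and inj: "inj_on h (carrier G)"
    using bij by (auto simp: bij_betw_def)
  have Nn: "N \<lhd> G" using N by (simp add: minimal_normal_def)
  have sub: "N \<subseteq> carrier G" using Nn normal_imp_subgroup subgroup.subset by blast
  have "h ` N \<noteq> {\<one>\<^bsub>H\<^esub>}"
  proof
    assume "h ` N = {\<one>\<^bsub>H\<^esub>}"
    then have "h ` N = h ` {\<one>}" by simp
    then have "N = {\<one>}" using inj_on_image_eq_iff[OF inj sub, of "{\<one>}"] by simp
    then show False using N by (simp add: minimal_normal_def)
  qed
  moreover have "K = {\<one>\<^bsub>H\<^esub>} \<or> K = h ` N" if K: "K \<lhd> H" "K \<subseteq> h ` N" for K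
  proof -
    let ?V = "{x \<in> carrier G. h x \<in> K}"
    have img: "h ` ?V = K" using K(2) sub by auto
    have "?V \<subseteq> N"
    proof clarify
      fix x assume x: "x \<in> carrier G" "h x \<in> K"
      then obtain n where "n \<in> N" "h x = h n" using K(2) by blast
      then show "x \<in> N" using inj x(1) sub by (metis inj_onD subsetD)
    qed
    then have "?V = {\<one>} \<or> ?V = N"
      using N vimage_normal[OF K(1)] by (simp add: minimal_normal_def)
    then show ?thesis using img by auto
  qed
  ultimately show ?thesis
    using normal.surj_hom_normal_subgroup[OF Nn group_hom_axioms surj]
    unfolding minimal_normal_def by blast
qed

lemma (in group) minimal_normal_subset_carrier: "minimal_normal N G \<Longrightarrow> N \<subseteq> carrier G"
  unfolding minimal_normal_def using normal_imp_subgroup subgroup.subset by blast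

lemma (in group) socle_subgroup: "subgroup (socle G) G"
  unfolding socle_def using minimal_normal_subset_carrier by (intro generate_is_subgroup) blast

text \<open>Conjugation by an element of \<open>G\<close> sends minimal normal subgroups of
  \<open>H\<close> to minimal normal subgroups of \<open>H\<close>, so it preserves the subgroup
  they generate.\<close>

lemma (in normal) socle_normal: "socle (G\<lparr>carrier := H\<rparr>) \<lhd> G"
proof (rule normal_invI)
  let ?H = "G\<lparr>carrier := H\<rparr>"
  let ?U = "\<Union> {N. minimal_normal N ?H}"
  have HG: "group ?H" by (rule subgroup_imp_group[OF subgroup_axioms])
  show "subgroup (socle ?H) G"
    by (rule incl_subgroup[OF subgroup_axioms group.socle_subgroup[OF HG]])
  fix g x assume g: "g \<in> carrier G" and x: "x \<in> socle ?H"
  interpret c: group_hom ?H ?H "\<lambda>x. g \<otimes> x \<otimes> inv g" by (rule conj_restrict(1)[OF g])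
  have "bij_betw (\<lambda>x. g \<otimes> x \<otimes> inv g) (carrier ?H) (carrier ?H)"
    using conj_restrict(2)[OF g] conj_inj_on[OF g subset] by (simp add: bij_betw_def)
  then have "(\<lambda>x. g \<otimes> x \<otimes> inv g) ` ?U \<subseteq> ?U"
    using c.iso_image_minimal_normal by blast
  moreover have "?U \<subseteq> carrier ?H"
    using group.minimal_normal_subset_carrier[OF HG] by blast
  ultimately have "(\<lambda>x. g \<otimes> x \<otimes> inv g) ` generate ?H ?U \<subseteq> generate ?H ?U"
    using c.generate_img[of ?U] group.mono_generate[OF HG] by metis
  then show "g \<otimes> x \<otimes> inv g \<in> socle ?H" using x by (auto simp: socle_def)
qed

text \<open>\<open>N\<close> need not be minimal normal in \<open>H\<close>, but it contains some
  \<open>R\<close> that is. So \<open>N\<close> meets the socle of \<open>H\<close> nontrivially,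
  and since this intersection is normal in \<open>G\<close>, it is all of \<open>N\<close>.\<close>

lemma (in normal) minimal_normal_le_socle:
  assumes fin: "finite (carrier G)" and N: "minimal_normal N G" "N \<subseteq> H"
  shows "N \<subseteq> socle (G\<lparr>carrier := H\<rparr>)"
proof -
  let ?H = "G\<lparr>carrier := H\<rparr>"
  have HG: "group ?H" by (rule subgroup_imp_group[OF subgroup_axioms])
  have Nn: "N \<lhd> G" and N1: "N \<noteq> {\<one>}" using N by (auto simp: minimal_normal_def)
  have "N \<lhd> ?H" by (rule normal_restrict_supergroup[OF subgroup_axioms Nn N(2)])
  then obtain R where R: "minimal_normal R ?H" "R \<subseteq> N"
    using group.normal_contains_minimal_normal[OF HG, of N] N1 finite_subset[OF subset fin] by auto
  have "R \<subseteq> socle ?H" using R(1) by (auto simp: socle_def intro: generate.incl)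
  then have le: "R \<subseteq> N \<inter> socle ?H" using R(2) by blast
  have "N \<inter> socle ?H \<lhd> G" by (rule normal_subgroup_intersect[OF Nn socle_normal])
  then have cases: "N \<inter> socle ?H = {\<one>} \<or> N \<inter> socle ?H = N"
    using N(1) by (simp add: minimal_normal_def)
  have "R \<noteq> {\<one>}" "\<one> \<in> R"
    using R(1) subgroup.one_closed[OF normal_imp_subgroup[of R ?H]] by (auto simp: minimal_normal_def)
  then show ?thesis using cases le by blast
qed

lemma (in group) centralizer_normal:
  assumes N: "N \<lhd> G"
  shows "{g \<in> carrier G. \<forall>n\<in>N. g \<otimes> n = n \<otimes> g} \<lhd> G"
proof (rule normal_invI)
  have sub: "N \<subseteq> carrier G" by (rule subgroup.subset[OF normal_imp_subgroup[OF N]])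
  show "subgroup {g \<in> carrier G. \<forall>n\<in>N. g \<otimes> n = n \<otimes> g} G"
    by (rule centralizer_subgroup[OF sub])
  fix x c assume x: "x \<in> carrier G" and c: "c \<in> {g \<in> carrier G. \<forall>n\<in>N. g \<otimes> n = n \<otimes> g}"
  have "x \<otimes> c \<otimes> inv x \<otimes> n = n \<otimes> (x \<otimes> c \<otimes> inv x)" if n: "n \<in> N" for n
  proof -
    define k where "k = inv x \<otimes> n \<otimes> x"
    have k: "k \<in> N" unfolding k_def by (rule normal.inv_op_closed1[OF N x n])
    have G: "c \<in> carrier G" "n \<in> carrier G" "k \<in> carrier G" using c n k sub by auto
    have nk: "n = x \<otimes> k \<otimes> inv x"
      unfolding k_def using x G by (simp add: m_assoc) (simp flip: m_assoc)
    have "x \<otimes> c \<otimes> inv x \<otimes> n = x \<otimes> (c \<otimes> k) \<otimes> inv x"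
      unfolding nk using x G by (simp add: m_assoc) (simp flip: m_assoc)
    also have "\<dots> = x \<otimes> (k \<otimes> c) \<otimes> inv x" using c k by simp
    also have "\<dots> = n \<otimes> (x \<otimes> c \<otimes> inv x)"
      unfolding nk using x G by (simp add: m_assoc) (simp flip: m_assoc)
    finally show ?thesis .
  qed
  then show "x \<otimes> c \<otimes> inv x \<in> {g \<in> carrier G. \<forall>n\<in>N. g \<otimes> n = n \<otimes> g}"
    using x c by simp
qed

text \<open>The preimage is the disjoint union of the cosets in \<open>S\<close>. The constant
  factor \<open>card H\<close> later cancels when indices are compared with those in the
  quotient.\<close>

lemma (in normal) card_vimage_rcosets:
  assumes fin: "finite (carrier G)" and S: "S \<subseteq> rcosets H"
  shows "card {x \<in> carrier G. H #> x \<in> S} = card S * card H"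
proof -
  have "{x \<in> carrier G. H #> x \<in> S} = \<Union> S"
  proof
    show "{x \<in> carrier G. H #> x \<in> S} \<subseteq> \<Union> S"
      using rcos_self[OF _ subgroup_axioms] by blast
    show "\<Union> S \<subseteq> {x \<in> carrier G. H #> x \<in> S}"
    proof clarify
      fix x C assume C: "C \<in> S" "x \<in> C"
      then obtain y where y: "y \<in> carrier G" "C = H #> y" using S by (auto simp: RCOSETS_def)
      then have "H #> x = C" using repr_independence[OF _ y(1) subgroup_axioms, of x] C(2) by simp
      moreover have "x \<in> carrier G" using y C(2) elemrcos_carrier[OF is_group] by blast
      ultimately show "x \<in> carrier G \<and> H #> x \<in> S" using C(1) by simp
    qed
  qed
  moreover have "card (\<Union> S) = (\<Sum>C\<in>S. card C)"
  proof (rule card_Union_disjoint)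
    show "pairwise disjnt S"
      using rcos_disjoint[OF subgroup_axioms] S by (meson pairwise_subset)
    show "finite C" if "C \<in> S" for C
      using that S rcosets_carrier[OF is_group] fin by (meson finite_subset subsetD)
  qed
  moreover have "(\<Sum>C\<in>S. card C) = (\<Sum>C\<in>S. card H)"
    by (rule sum.cong) (use S card_rcosets_equal[OF _ subset] in auto)
  ultimately show ?thesis by simp
qed

section \<open>Saturated formations\<close>

text \<open>Extends saturation from \<open>nat\<close> to any carrier type. It suffices that the
  Frattini subgroup of \<open>G\<close> lies in the preimage \<open>?K\<close> of that of the copy
  \<open>Y\<close>, because the quotient by the larger \<open>?K\<close> stays in the class.\<close>

lemma saturated_formation_frattini:
  assumes F: "saturated_formation F" and G: "group G" "finite (carrier G)"
    and q: "in_class F (G Mod frattini G)"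
  shows "in_class F G"
proof -
  have Ff: "formation F" using F by (simp add: saturated_formation_def)
  obtain Y :: "nat monoid" and f where Y: "group Y" "finite (carrier Y)" "f \<in> iso G Y"
    using group.nat_copy_exists[OF G] by blast
  interpret f: group_hom G Y f
    using Y G by (simp add: group_hom_def group_hom_axioms_def iso_def)
  have surj: "f ` carrier G = carrier Y" using Y(3) by (simp add: iso_def bij_betw_def)
  let ?K = "{x \<in> carrier G. f x \<in> frattini Y}"
  have \<Phi>: "frattini Y \<lhd> Y" by (rule f.H.frattini_self_normal)
  have K: "?K \<lhd> G" by (rule f.vimage_normal[OF \<Phi>])
  have "frattini G \<subseteq> ?K"
    using f.frattini_image[OF surj] by (auto simp: frattini_def)
  then have "in_class F (G Mod ?K)"
    using formation_quotient_mono[OF Ff G(1) f.G.frattini_self_normal q K] by blast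
  then have "in_class F (Y Mod frattini Y)"
    using f.FactGroup_vimage_iso[OF surj \<Phi>] normal.factorgroup_is_group[OF \<Phi>]
    by (rule in_class_iso)
  then have "in_class F Y" using F Y unfolding saturated_formation_def by blast
  then show ?thesis
    using group.iso_sym[OF G(1) is_isoI[OF Y(3)]] G(1) by (rule in_class_iso)
qed

text \<open>The quotient in question is a subgroup of the affine group of the field with
  \<open>card N\<close> elements.\<close>

lemma in_class_Mod_prime_complement:
  fixes G :: "('a, 'b) monoid_scheme" and N M :: "'a set"
  defines "L \<equiv> {g \<in> carrier G. \<forall>n\<in>N. g \<otimes>\<^bsub>G\<^esub> n = n \<otimes>\<^bsub>G\<^esub> g} \<inter> M"
  assumes U: "\<forall>K :: nat monoid. group K \<and> finite (carrier K) \<and> supersoluble K \<longrightarrow> in_class F K"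
    and G: "group G" "finite (carrier G)"
    and N: "N \<lhd> G" "Factorial_Ring.prime (card N)"
    and M: "subgroup M G" "N \<inter> M = {\<one>\<^bsub>G\<^esub>}" "N <#>\<^bsub>G\<^esub> M = carrier G"
  shows "L \<lhd> G" and "in_class F (G Mod L)"
proof -
  interpret G: group G by (rule G(1))
  let ?C = "{g \<in> carrier G. \<forall>n\<in>N. g \<otimes>\<^bsub>G\<^esub> n = n \<otimes>\<^bsub>G\<^esub> g}"
  have Ns: "subgroup N G" using N(1) by (rule normal_imp_subgroup)
  have NG: "N \<subseteq> carrier G" by (rule subgroup.subset[OF Ns])
  have Cn: "?C \<lhd> G" by (rule G.centralizer_normal[OF N(1)])
  have Cs: "subgroup ?C G" using Cn by (rule normal_imp_subgroup)
  have decomp: "\<exists>n\<in>N. \<exists>m\<in>M. x = n \<otimes>\<^bsub>G\<^esub> m" if "x \<in> carrier G" for x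
    using that unfolding M(3)[symmetric] by (auto simp: set_mult_def)
  have Ls: "subgroup L G"
    unfolding L_def by (rule G.subgroups_Inter_pair[OF Cs M(1)])
  show Ln: "L \<lhd> G"
  \<comment> \<open>Write \<open>x\<close> as \<open>n\<close> times \<open>m\<close>. Conjugation
    by \<open>m\<close> keeps \<open>l\<close> in \<open>L\<close>, since the centralizer is normal
    and \<open>m\<close> is in \<open>M\<close>; conjugation by \<open>n\<close> then changes
    nothing, since elements of \<open>L\<close> centralize \<open>N\<close>.\<close>
  proof (rule G.normal_invI[OF Ls])
    fix x l assume x: "x \<in> carrier G" and l: "l \<in> L"
    obtain n m where nm: "n \<in> N" "m \<in> M" "x = n \<otimes>\<^bsub>G\<^esub> m" using decomp[OF x] by blast
    define y where "y = m \<otimes>\<^bsub>G\<^esub> l \<otimes>\<^bsub>G\<^esub> inv\<^bsub>G\<^esub> m"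
    have xy: "n \<in> carrier G" "m \<in> carrier G" "l \<in> carrier G"
      using nm l NG subgroup.mem_carrier[OF M(1)] by (auto simp: L_def)
    have "y \<in> M"
      unfolding y_def using nm(2) l
      by (auto simp: L_def intro!: subgroup.m_closed[OF M(1)] subgroup.m_inv_closed[OF M(1)])
    moreover have "y \<in> ?C"
      unfolding y_def by (rule normal.inv_op_closed2[OF Cn xy(2)]) (use l in \<open>simp add: L_def\<close>)
    ultimately have y: "y \<in> L" "y \<in> carrier G" "y \<otimes>\<^bsub>G\<^esub> n = n \<otimes>\<^bsub>G\<^esub> y" using nm(1) by (auto simp: L_def)
    have "x \<otimes>\<^bsub>G\<^esub> l \<otimes>\<^bsub>G\<^esub> inv\<^bsub>G\<^esub> x = n \<otimes>\<^bsub>G\<^esub> y \<otimes>\<^bsub>G\<^esub> inv\<^bsub>G\<^esub> n"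
      unfolding nm(3) y_def using xy by (simp add: G.m_assoc G.inv_mult_group)
    also have "\<dots> = y"
      using y(2) xy(1) by (simp flip: y(3)) (simp add: G.m_assoc)
    finally show "x \<otimes>\<^bsub>G\<^esub> l \<otimes>\<^bsub>G\<^esub> inv\<^bsub>G\<^esub> x \<in> L" using y(1) by simp
  qed
  have NL: "x = \<one>\<^bsub>G\<^esub>" if "x \<in> N" "x \<in> L" for x
    using that M(2) by (auto simp: L_def)
  interpret L: normal L G by (rule Ln)
  interpret Q: group "G Mod L" by (rule L.factorgroup_is_group)
  have "finite (carrier (G Mod L))" using G(2) by (simp add: carrier_FactGroup)
  then obtain Y :: "nat monoid" and f where Y: "group Y" "finite (carrier Y)" "f \<in> iso (G Mod L) Y"
    using Q.nat_copy_exists by blast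
  interpret Y: group Y by (rule Y(1))
  have f: "f \<in> hom (G Mod L) Y" "bij_betw f (carrier (G Mod L)) (carrier Y)"
    using Y(3) by (auto simp: iso_def)
  \<comment> \<open>The supersolubility assumption \<open>U\<close> speaks of groups on
    \<open>nat\<close>, so the quotient by \<open>L\<close> is replaced by its copy
    \<open>Y\<close>. The composite \<open>h\<close> has kernel \<open>L\<close> and is injective on
    \<open>N\<close>, as \<open>N\<close> and \<open>L\<close> meet trivially.\<close>
  define h where "h = f \<circ> (\<lambda>x. L #>\<^bsub>G\<^esub> x)"
  interpret h: group_hom G Y h
    unfolding group_hom_def group_hom_axioms_def h_def
    using Group.hom_compose[OF L.r_coset_hom_Mod f(1)] G(1) Y(1) by simp
  have surj: "h ` carrier G = carrier Y"
    unfolding h_def image_comp[symmetric] carrier_FactGroup[symmetric]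
    using f(2) by (simp add: bij_betw_def)
  have ker: "kernel G Y h = L"
  proof -
    have "f L = \<one>\<^bsub>Y\<^esub>" using hom_one[OF f(1) Q.group_axioms Y(1)] by simp
    then have "h x = \<one>\<^bsub>Y\<^esub> \<longleftrightarrow> L #>\<^bsub>G\<^esub> x = L" if "x \<in> carrier G" for x
      using that inj_on_eq_iff[OF bij_betw_imp_inj_on[OF f(2)], of "L #>\<^bsub>G\<^esub> x" L] Q.one_closed
      by (simp add: h_def carrier_FactGroup)
    then have "kernel G Y h = kernel G (G Mod L) (\<lambda>x. L #>\<^bsub>G\<^esub> x)" by (auto simp: kernel_def)
    then show ?thesis by (simp add: L.kernel_rcos)
  qed
  have inj: "inj_on h N"
  proof (rule inj_onI)
    fix x y assume xy: "x \<in> N" "y \<in> N" "h x = h y"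
    have c: "x \<in> carrier G" "y \<in> carrier G" using xy NG by auto
    have "x \<otimes>\<^bsub>G\<^esub> inv\<^bsub>G\<^esub> y \<in> kernel G Y h" using c xy(3) by (simp add: kernel_def)
    then have "x \<otimes>\<^bsub>G\<^esub> inv\<^bsub>G\<^esub> y = \<one>\<^bsub>G\<^esub>"
      using NL ker xy by (simp add: subgroup.m_closed[OF Ns] subgroup.m_inv_closed[OF Ns])
    then show "x = y" using c by (metis G.inv_equality G.inv_inv G.inv_closed)
  qed
  have "card (h ` N) = card N" by (rule card_image[OF inj])
  then have p': "Factorial_Ring.prime (card (h ` N))" using N(2) by simp
  have N': "h ` N \<lhd> Y"
    by (rule normal.surj_hom_normal_subgroup[OF N(1) h.group_hom_axioms surj])
  have Ncomm: "N \<subseteq> ?C"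
  proof
    fix x assume x: "x \<in> N"
    have "x \<otimes>\<^bsub>G\<^esub> y = y \<otimes>\<^bsub>G\<^esub> x" if y: "y \<in> N" for y
    proof (cases "x = \<one>\<^bsub>G\<^esub>")
      case True
      then show ?thesis using y NG by auto
    next
      case False
      obtain k :: nat where "y = x [^]\<^bsub>G\<^esub> k"
        using G.prime_order_subgroup_powers(2)[OF G(2) Ns N(2) x False] y by blast
      then show ?thesis
        using x NG G.nat_pow_comm[of x 1 k] by auto
    qed
    then show "x \<in> ?C" using x NG by blast
  qed
  \<comment> \<open>A lift \<open>g\<close> of a centralizing \<open>y\<close> centralizes
    \<open>N\<close>, since \<open>g \<otimes> n \<otimes> inv g\<close> and \<open>n\<close> lie in
    \<open>N\<close> and have the same image. Removing its factor in the abelian group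
    \<open>N\<close> leaves an \<open>m\<close> in \<open>M\<close> that centralizes
    \<open>N\<close>, that is, an element of the kernel \<open>L\<close>.\<close>
  have "{y \<in> carrier Y. \<forall>n\<in>h ` N. y \<otimes>\<^bsub>Y\<^esub> n = n \<otimes>\<^bsub>Y\<^esub> y} \<subseteq> h ` N"
  proof clarify
    fix y assume y: "y \<in> carrier Y" "\<forall>n\<in>h ` N. y \<otimes>\<^bsub>Y\<^esub> n = n \<otimes>\<^bsub>Y\<^esub> y"
    then obtain g where g: "g \<in> carrier G" "y = h g" using surj by auto
    have "g \<otimes>\<^bsub>G\<^esub> n = n \<otimes>\<^bsub>G\<^esub> g" if n: "n \<in> N" for n
    proof -
      have nG: "n \<in> carrier G" using n NG by auto
      have "h (g \<otimes>\<^bsub>G\<^esub> n \<otimes>\<^bsub>G\<^esub> inv\<^bsub>G\<^esub> g) = h n"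
      proof -
        have "h (g \<otimes>\<^bsub>G\<^esub> n \<otimes>\<^bsub>G\<^esub> inv\<^bsub>G\<^esub> g) = h n \<otimes>\<^bsub>Y\<^esub> h g \<otimes>\<^bsub>Y\<^esub> inv\<^bsub>Y\<^esub> h g"
          using y(2) g n nG by simp
        also have "\<dots> = h n" using g nG by (simp add: Y.m_assoc)
        finally show ?thesis .
      qed
      then have "g \<otimes>\<^bsub>G\<^esub> n \<otimes>\<^bsub>G\<^esub> inv\<^bsub>G\<^esub> g = n"
        using inj_onD[OF inj] n normal.inv_op_closed2[OF N(1) g(1) n] by blast
      then have "g \<otimes>\<^bsub>G\<^esub> n \<otimes>\<^bsub>G\<^esub> inv\<^bsub>G\<^esub> g \<otimes>\<^bsub>G\<^esub> g = n \<otimes>\<^bsub>G\<^esub> g" by simp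
      then show ?thesis using g nG by (simp add: G.m_assoc)
    qed
    then have gC: "g \<in> ?C" using g by blast
    obtain n m where nm: "n \<in> N" "m \<in> M" "g = n \<otimes>\<^bsub>G\<^esub> m" using decomp[OF g(1)] by blast
    have c: "n \<in> carrier G" "m \<in> carrier G" using nm NG subgroup.mem_carrier[OF M(1)] by auto
    have "inv\<^bsub>G\<^esub> n \<otimes>\<^bsub>G\<^esub> g \<in> ?C"
      by (rule subgroup.m_closed[OF Cs subgroup.m_inv_closed[OF Cs subsetD[OF Ncomm nm(1)]] gC])
    moreover have "inv\<^bsub>G\<^esub> n \<otimes>\<^bsub>G\<^esub> g = m"
      using c unfolding nm(3) by (simp flip: G.m_assoc)
    ultimately have "m \<in> ?C" by (simp only:)
    then have "m \<in> L" unfolding L_def using nm(2) by (rule IntI)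
    then have "m \<in> kernel G Y h" unfolding ker .
    then have "h m = \<one>\<^bsub>Y\<^esub>" by (simp add: kernel_def)
    then have "y = h n" using g(2) nm(3) c by simp
    then show "y \<in> h ` N" using nm(1) by blast
  qed
  then have "supersoluble Y"
    by (rule Y.supersoluble_if_prime_self_centralizing[OF Y(2) N' p'])
  then have "in_class F Y" using U Y by blast
  moreover have "G Mod L \<cong> Y" using h.FactGroup_iso[OF surj] ker by simp
  ultimately show "in_class F (G Mod L)"
    using in_class_iso[OF _ Q.iso_sym Q.group_axioms] by blast
qed

text \<open>The case to which the theorem is reduced. \<open>T\<close> stands for the socle of
  \<open>H\<close>; the argument uses that it is normal in \<open>G\<close>, contains the minimal
  normal subgroups of \<open>G\<close> inside \<open>H\<close>, and satisfies the index
  condition.\<close>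

lemma in_class_if_frattini_inter_trivial:
  assumes F: "formation F"
    and U: "\<forall>K :: nat monoid. group K \<and> finite (carrier K) \<and> supersoluble K \<longrightarrow> in_class F K"
    and G: "group G" "finite (carrier G)"
    and H: "H \<lhd> G" "in_class F (G Mod H)"
    and \<Phi>: "frattini G \<inter> H = {\<one>\<^bsub>G\<^esub>}"
    and T: "T \<lhd> G" "\<And>N. \<lbrakk>minimal_normal N G; N \<subseteq> H\<rbrakk> \<Longrightarrow> N \<subseteq> T"
    and idx: "\<And>M. maximal_subgroup M G \<Longrightarrow>
        card T div card (T \<inter> M) = 1 \<or> Factorial_Ring.prime (card T div card (T \<inter> M))"
  shows "in_class F G"
proof -
  interpret G: group G by (rule G(1))
  have separate: "\<exists>L. L \<lhd> G \<and> in_class F (G Mod L) \<and> \<not> N \<subseteq> L"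
    if N: "minimal_normal N G" "N \<subseteq> H" for N
  proof -
    have Nn: "N \<lhd> G" and N1: "N \<noteq> {\<one>\<^bsub>G\<^esub>}" using N(1) by (auto simp: minimal_normal_def)
    have one: "\<one>\<^bsub>G\<^esub> \<in> N" by (rule subgroup.one_closed[OF normal_imp_subgroup[OF Nn]])
    have NG: "N \<subseteq> carrier G" by (rule G.minimal_normal_subset_carrier[OF N(1)])
    have "\<not> N \<subseteq> frattini G" using N(2) \<Phi> N1 one by blast
    then obtain M where M: "maximal_subgroup M G" "\<not> N \<subseteq> M"
      using NG by (auto simp: frattini_def)
    have Ms: "subgroup M G" using M by (simp add: maximal_subgroup_def)
    \<comment> \<open>Both \<open>N\<close> and the larger \<open>T\<close> supplement
      \<open>M'\<close>, so both indices equal that of \<open>M'\<close> in \<open>G\<close>. This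
      index is not 1, so the index condition on \<open>T\<close> leaves only a prime.\<close>
    have pr: "Factorial_Ring.prime (card N div card (N \<inter> M'))"
      if M': "maximal_subgroup M' G" "\<not> N \<subseteq> M'" for M'
    proof -
      have M's: "subgroup M' G" "M' \<noteq> carrier G" using M' by (simp_all add: maximal_subgroup_def)
      have "card N div card (N \<inter> M') = order G div card M'"
        by (rule G.card_div_inter_normal[OF G(2) Nn M's(1) G.mult_normal_maximal_eq_carrier[OF Nn M']])
      moreover have "\<not> T \<subseteq> M'" using T(2)[OF N] M'(2) by blast
      then have "card T div card (T \<inter> M') = order G div card M'"
        using G.card_div_inter_normal[OF G(2) T(1) M's(1) G.mult_normal_maximal_eq_carrier[OF T(1) M'(1)]]
        by blast
      moreover have "order G div card M' \<noteq> 1"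
      proof
        assume "order G div card M' = 1"
        moreover have "card M' > 0" by (rule subgroup.finite_imp_card_positive[OF M's(1) G(2)])
        moreover note G.lagrange[OF M's(1)]
        ultimately have "card M' = order G"
          by (metis div_mult_self_is_m mult_1)
        then have "M' = carrier G"
          using card_subset_eq[OF G(2) subgroup.subset[OF M's(1)]] by (simp add: order_def)
        then show False using M's(2) by simp
      qed
      ultimately show ?thesis using idx[OF M'(1)] by simp
    qed
    have NM: "N \<inter> M = {\<one>\<^bsub>G\<^esub>}" "Factorial_Ring.prime (card N)"
      using G.minimal_normal_prime_order[OF G(2) N(1) pr M] by auto
    note L = in_class_Mod_prime_complement[OF U G Nn NM(2) Ms NM(1)
        G.mult_normal_maximal_eq_carrier[OF Nn M]]
    show ?thesis using L M(2) by blast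
  qed
  let ?P = "\<lambda>K. K \<lhd> G \<and> K \<subseteq> H \<and> in_class F (G Mod K)"
  \<comment> \<open>\<open>H\<close> itself satisfies \<open>?P\<close>, so a \<open>K\<close> of
    least order exists. Intersecting it with a separating \<open>L\<close> would give a smaller one,
    unless \<open>K\<close> is trivial.\<close>
  obtain K where K: "?P K" and least: "\<And>K'. ?P K' \<Longrightarrow> card K \<le> card K'"
    using ex_has_least_nat[of ?P H card] H by blast
  have "K = {\<one>\<^bsub>G\<^esub>}"
  proof (rule ccontr)
    assume "K \<noteq> {\<one>\<^bsub>G\<^esub>}"
    then obtain N where N: "minimal_normal N G" "N \<subseteq> K"
      using G.normal_contains_minimal_normal[OF G(2)] K by blast
    then obtain L where L: "L \<lhd> G" "in_class F (G Mod L)" "\<not> N \<subseteq> L"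
      using separate[of N] K by blast
    have "?P (K \<inter> L)"
      using formation_inter[OF F G _ L(1) _ L(2)] G.normal_subgroup_intersect[OF _ L(1)] K by blast
    then have "card K \<le> card (K \<inter> L)" by (rule least)
    moreover have "finite K"
      using K finite_subset[OF subgroup.subset[OF normal_imp_subgroup] G(2)] by blast
    ultimately have "K \<inter> L = K" by (metis card_seteq inf_le1)
    then show False using L(3) N(2) by blast
  qed
  then have "in_class F (G Mod {\<one>\<^bsub>G\<^esub>})" using K by simp
  then show ?thesis
    using is_isoI[OF G.trivial_factor_iso] G(1) by (rule in_class_iso)
qed

section \<open>Reduction modulo the Frattini subgroup of \<open>H\<close>\<close>

theorem theorem2:
  fixes F :: "nat monoid \<Rightarrow> bool" and G :: "('a, 'b) monoid_scheme" and H :: "'a set"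
  assumes "saturated_formation F"
    and "\<forall>K :: nat monoid. group K \<and> finite (carrier K) \<and> supersoluble K \<longrightarrow> in_class F K"
    and "group G" and "finite (carrier G)"
    and "H \<lhd> G"
    and "in_class F (G Mod H)"
    and "frattini G \<inter> H \<subseteq> frattini (G\<lparr>carrier := H\<rparr>)"
    and "\<forall>M. maximal_subgroup M G \<longrightarrow>
           (let T = gen_fitting_tilde (G\<lparr>carrier := H\<rparr>) in
              card T div card (T \<inter> M) = 1 \<or> Factorial_Ring.prime (card T div card (T \<inter> M)))"
  shows "in_class F G"
proof -
  have Ff: "formation F" using assms(1) by (simp add: saturated_formation_def)
  interpret H: normal H G by (rule assms(5))
  let ?H = "G\<lparr>carrier := H\<rparr>"
  define P where "P = frattini ?H"
  have Pn: "P \<lhd> G" unfolding P_def by (rule H.frattini_normal)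
  have PH: "P \<subseteq> H" by (auto simp: P_def frattini_def)
  have P\<Phi>: "P \<subseteq> frattini G" unfolding P_def by (rule H.frattini_mono[OF assms(4)])
  interpret P: normal P G by (rule Pn)
  let ?h = "\<lambda>x. P #>\<^bsub>G\<^esub> x"
  define G' where "G' = G Mod P"
  interpret h: group_hom G G' ?h unfolding G'_def by (rule P.rcos_group_hom)
  have ker: "kernel G G' ?h = P" unfolding G'_def by (rule P.kernel_rcos)
  have surj: "?h ` carrier G = carrier G'" by (simp add: G'_def carrier_FactGroup)
  have one': "\<one>\<^bsub>G'\<^esub> = P" by (simp add: G'_def)
  have fin': "finite (carrier G')" using assms(4) surj[symmetric] by simp
  define H' where "H' = ?h ` H"
  have Hn': "H' \<lhd> G'"
    unfolding H'_def by (rule H.surj_hom_normal_subgroup[OF h.group_hom_axioms surj])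
  interpret H': normal H' G' by (rule Hn')
  have vimH: "{x \<in> carrier G. ?h x \<in> H'} = H"
    unfolding H'_def by (rule h.vimage_image_subgroup[OF H.subgroup_axioms]) (simp add: ker PH)
  have quot: "in_class F (G' Mod H')"
    using assms(6) h.FactGroup_vimage_iso[OF surj Hn', unfolded vimH] H'.factorgroup_is_group
    by (rule in_class_iso)
  have \<Phi>': "frattini G' \<inter> H' = {\<one>\<^bsub>G'\<^esub>}"
  proof
    show "frattini G' \<inter> H' \<subseteq> {\<one>\<^bsub>G'\<^esub>}"
    proof
      fix C assume C: "C \<in> frattini G' \<inter> H'"
      then obtain x where x: "x \<in> H" "C = ?h x" by (auto simp: H'_def)
      \<comment> \<open>Every maximal \<open>M\<close> contains \<open>P\<close>, so its image in
        \<open>G'\<close> is maximal and contains the coset of \<open>x\<close>. Thus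
        \<open>x\<close> lies in the Frattini subgroup of \<open>G\<close> and in \<open>H\<close>,
        and the assumed inclusion puts it in \<open>P\<close>.\<close>
      have "x \<in> M" if M: "maximal_subgroup M G" for M
      proof -
        have Ms: "subgroup M G" using M by (simp add: maximal_subgroup_def)
        have PM: "kernel G G' ?h \<subseteq> M" using P\<Phi> M ker by (auto simp: frattini_def)
        have "?h x \<in> ?h ` M"
          using h.image_maximal[OF surj M PM] C x(2) by (auto simp: frattini_def)
        then have "x \<in> {x \<in> carrier G. ?h x \<in> ?h ` M}" using x(1) by simp
        then show ?thesis using h.vimage_image_subgroup[OF Ms PM] by simp
      qed
      then have "x \<in> frattini G" using x(1) by (simp add: frattini_def)
      then have "x \<in> P" using assms(7) x(1) by (auto simp: P_def)
      then show "C \<in> {\<one>\<^bsub>G'\<^esub>}" using x ker by (auto simp: kernel_def)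
    qed
    show "{\<one>\<^bsub>G'\<^esub>} \<subseteq> frattini G' \<inter> H'"
      using subgroup.one_closed[OF h.H.frattini_subgroup] by simp
  qed
  define T where "T = socle (G'\<lparr>carrier := H'\<rparr>)"
  \<comment> \<open>An equality of records, not just an isomorphism: the cosets of \<open>P\<close>
    in \<open>H\<close> are also cosets in \<open>G\<close>. Hence the socle in the definition of
    \<open>gen_fitting_tilde\<close> is literally \<open>T\<close>.\<close>
  have quotH: "?H Mod P = G'\<lparr>carrier := H'\<rparr>"
  proof -
    have "set_mult ?H = set_mult G" by (intro ext) simp
    then show ?thesis
      by (auto simp: G'_def H'_def FactGroup_def RCOSETS_def)
  qed
  have TH: "T \<subseteq> H'"
    unfolding T_def
    using subgroup.subset[OF group.socle_subgroup[OF h.H.subgroup_imp_group[OF H'.subgroup_axioms]]] by simp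
  have tilde: "gen_fitting_tilde ?H = {x \<in> carrier G. ?h x \<in> T}"
  proof -
    have "gen_fitting_tilde ?H = {x \<in> H. ?h x \<in> T}"
      by (simp add: gen_fitting_tilde_def quotH[unfolded P_def] T_def P_def)
    then show ?thesis using vimH TH by blast
  qed
  have rc: "carrier G' = rcosets\<^bsub>G\<^esub> P" by (simp add: G'_def FactGroup_def)
  have idx: "card T div card (T \<inter> M) = 1 \<or> Factorial_Ring.prime (card T div card (T \<inter> M))"
    if M: "maximal_subgroup M G'" for M
  proof -
    let ?M = "{x \<in> carrier G. ?h x \<in> M}"
    have "maximal_subgroup ?M G" by (rule h.vimage_maximal[OF surj M])
    then have main: "card {x \<in> carrier G. ?h x \<in> T} div card ({x \<in> carrier G. ?h x \<in> T} \<inter> ?M) = 1 \<or>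
        Factorial_Ring.prime (card {x \<in> carrier G. ?h x \<in> T} div card ({x \<in> carrier G. ?h x \<in> T} \<inter> ?M))"
      using assms(8) by (simp add: Let_def tilde)
    \<comment> \<open>Over \<open>T\<close> and over \<open>T \<inter> M\<close> the preimages are
      larger by the same factor \<open>card P\<close>, so the two indices agree.\<close>
    have TG: "T \<subseteq> rcosets\<^bsub>G\<^esub> P" using TH H'.subset rc by simp
    have c1: "card {x \<in> carrier G. ?h x \<in> T} = card T * card P"
      by (rule P.card_vimage_rcosets[OF assms(4) TG])
    have "{x \<in> carrier G. ?h x \<in> T} \<inter> ?M = {x \<in> carrier G. ?h x \<in> T \<inter> M}" by auto
    then have c2: "card ({x \<in> carrier G. ?h x \<in> T} \<inter> ?M) = card (T \<inter> M) * card P"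
      using P.card_vimage_rcosets[OF assms(4), of "T \<inter> M"] TG by auto
    have "card P > 0" by (rule P.finite_imp_card_positive[OF assms(4)])
    then show ?thesis using main unfolding c1 c2 by simp
  qed
  have "T \<lhd> G'" unfolding T_def by (rule H'.socle_normal)
  then have "in_class F G'"
    using in_class_if_frattini_inter_trivial[OF Ff assms(2) h.H.group_axioms fin' Hn' quot \<Phi>' _ _ idx]
      H'.minimal_normal_le_socle[OF fin', folded T_def] by blast
  \<comment> \<open>\<open>P\<close> lies in the Frattini subgroup of \<open>G\<close>, so the
    quotient by the latter is a quotient of \<open>G'\<close>; saturation then lifts membership to
    \<open>G\<close>.\<close>
  then have "in_class F (G Mod frattini G)"
    unfolding G'_def
    by (rule formation_quotient_mono[OF Ff assms(3) Pn _ group.frattini_self_normal[OF assms(3)] P\<Phi>])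
  then show ?thesis
    by (rule saturated_formation_frattini[OF assms(1,3,4)])
qed

end
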